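(* Let $d$ be prime, $n\ge1$, $G$ positive and invertible over $\mathbb Z_d$, and $\sigma$ a pure $n$-qudit state. Then the channel $\mathcal E_\sigma(\rho)=\rho\boxtimes\sigma$ has Holevo capacity $\chi_H(\mathcal E_\sigma)=n\log d$ (the maximal possible value) if and only if $\sigma$ is a stabilizer state.
   Context: Fix a prime $d$; $\chi(k)=e^{2\pi ik/d}$, $X|k\rangle=|k+1\rangle$, $Z|k\rangle=\chi(k)|k\rangle$ on $\mathbb C^d$; Weyl operators $w(p,q)=\chi(-2^{-1}pq)Z^pX^q$ (odd $d$), $w(p,q)=i^{-pq}Z^pX^q$ ($d=2$), $w(\vec p,\vec q)=\bigotimes_kw(p_k,q_k)$. A pure stabilizer state is a common eigenvector of an abelian group of $d^n$ Weyl operators (up to phases). $G=\begin{pmatrix}g_{00}&g_{01}\\ g_{10}&g_{11}\end{pmatrix}$ over $\mathbb Z_d$, $\det G\not\equiv0$, $N=(\det G)^{-1}$; positive means all entries nonzero mod $d$. Key unitary $U|\vec i\rangle|\vec j\rangle=|Ng_{11}\vec i-Ng_{10}\vec j\rangle|-Ng_{01}\vec i+Ng_{00}\vec j\rangle$; $\rho\boxtimes\sigma=\mathrm{Tr}_B[U(\rho\otimes\sigma)U^\dagger]$. Holevo capacity: $\chi_H(\mathcal E)=\max_{\{p_i,\rho_i\}}\big[H(\sum_ip_i\mathcal E(\rho_i))-\sum_ip_iH(\mathcal E(\rho_i))\big]$, $H$ von Neumann entropy. *)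

theory Defs
  imports "Jordan_Normal_Form.Char_Poly" "HOL-Number_Theory.Cong"
begin

definition adj :: "complex mat \<Rightarrow> complex mat" where
  "adj A = mat (dim_col A) (dim_row A) (\<lambda>(i,j). cnj (A $$ (j,i)))"

definition density_op :: "nat \<Rightarrow> complex mat \<Rightarrow> bool" where
  "density_op D A \<longleftrightarrow> A \<in> carrier_mat D D \<and> adj A = A \<and>
     (\<forall>v \<in> carrier_vec D. 0 \<le> Re (conjugate v \<bullet> (A *\<^sub>v v))) \<and> (\<Sum>i<D. A $$ (i,i)) = 1"

text \<open>Von Neumann entropy (natural logarithm): H(A) = - sum of lambda ln lambda over the
  eigenvalues of A counted with algebraic multiplicity (roots of the characteristic
  polynomial); note that ln 0 = 0 in Isabelle, giving the convention 0 ln 0 = 0.\<close>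
definition vn_entropy :: "complex mat \<Rightarrow> real" where
  "vn_entropy A = - (\<Sum>x \<in> {x. poly (char_poly A) x = 0}.
       real (order x (char_poly A)) * (Re x * ln (Re x)))"

definition holevo_capacity :: "nat \<Rightarrow> (complex mat \<Rightarrow> complex mat) \<Rightarrow> real" where
  "holevo_capacity D E = Sup {vn_entropy
        (let M = (\<lambda>i. E (\<rho> i)) in
          mat (dim_row (M 0)) (dim_col (M 0)) (\<lambda>(r,c). \<Sum>i<m. complex_of_real (p i) * M i $$ (r,c)))
        - (\<Sum>i<m. p i * vn_entropy (E (\<rho> i))) | m p \<rho>.
        0 < (m::nat) \<and> (\<forall>i<m. 0 \<le> p i \<and> density_op D (\<rho> i)) \<and> (\<Sum>i<m. p i) = 1}"

text \<open>Tensor product of a matrix on C^D with a matrix on C^D (basis |a>|b> has index a*D+b),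
  and the partial trace over the second factor.\<close>
definition tensor :: "nat \<Rightarrow> complex mat \<Rightarrow> complex mat \<Rightarrow> complex mat" where
  "tensor D A B = mat (D*D) (D*D) (\<lambda>(r,c). A $$ (r div D, c div D) * B $$ (r mod D, c mod D))"

definition ptrace2 :: "nat \<Rightarrow> complex mat \<Rightarrow> complex mat" where
  "ptrace2 D M = mat D D (\<lambda>(a,a'). \<Sum>b<D. M $$ (a*D+b, a'*D+b))"

definition outer :: "complex vec \<Rightarrow> complex mat" where
  "outer \<psi> = mat (dim_vec \<psi>) (dim_vec \<psi>) (\<lambda>(i,j). \<psi> $ i * cnj (\<psi> $ j))"

text \<open>Computational basis of (C^d)^{\<otimes> n}: index i < d^n, the k-th qudit (k < n) is the
  k-th base-d digit. Elements of Z_d^n are encoded the same way.\<close>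
definition digit :: "nat \<Rightarrow> nat \<Rightarrow> nat \<Rightarrow> nat" where
  "digit d k i = (i div d ^ k) mod d"

definition enc :: "nat \<Rightarrow> nat \<Rightarrow> (nat \<Rightarrow> int) \<Rightarrow> nat" where
  "enc d n f = (\<Sum>k<n. nat (f k mod int d) * d ^ k)"

definition inv_mod :: "nat \<Rightarrow> int \<Rightarrow> int" where
  "inv_mod d a = (SOME N. 0 \<le> N \<and> N < int d \<and> [N * a = 1] (mod int d))"

definition key_perm :: "nat \<Rightarrow> nat \<Rightarrow> int \<Rightarrow> int \<Rightarrow> int \<Rightarrow> int \<Rightarrow> nat \<Rightarrow> nat" where
  "key_perm d n g00 g01 g10 g11 x =
     (let D = d ^ n; i = x div D; j = x mod D; N = inv_mod d (g00 * g11 - g01 * g10) in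
      enc d n (\<lambda>k. N * g11 * int (digit d k i) - N * g10 * int (digit d k j)) * D
      + enc d n (\<lambda>k. - N * g01 * int (digit d k i) + N * g00 * int (digit d k j)))"

definition key_unitary :: "nat \<Rightarrow> nat \<Rightarrow> int \<Rightarrow> int \<Rightarrow> int \<Rightarrow> int \<Rightarrow> complex mat" where
  "key_unitary d n g00 g01 g10 g11 =
     mat (d^n * d^n) (d^n * d^n) (\<lambda>(r,c). if r = key_perm d n g00 g01 g10 g11 c then 1 else 0)"

definition boxtimes :: "nat \<Rightarrow> nat \<Rightarrow> int \<Rightarrow> int \<Rightarrow> int \<Rightarrow> int \<Rightarrow> complex mat \<Rightarrow> complex mat \<Rightarrow> complex mat" where
  "boxtimes d n g00 g01 g10 g11 \<rho> \<sigma> =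
     (let U = key_unitary d n g00 g01 g10 g11 in
      ptrace2 (d ^ n) (U * tensor (d ^ n) \<rho> \<sigma> * adj U))"

text \<open>Single-qudit Weyl operators w(p,q), p q in {0..<d}:
  chi(k) = exp(2 pi i k / d), Z^p X^q |k> = chi(p(k+q)) |k+q>;
  w(p,q) = chi(-2^{-1} p q) Z^p X^q for odd d (2^{-1} = (d+1)/2 mod d),
  w(p,q) = i^{-pq} Z^p X^q for d = 2.\<close>
definition chi :: "nat \<Rightarrow> int \<Rightarrow> complex" where
  "chi d k = cis (2 * pi * of_int k / of_nat d)"

definition weyl_phase :: "nat \<Rightarrow> nat \<Rightarrow> nat \<Rightarrow> complex" where
  "weyl_phase d p q = (if d = 2 then \<i> powi (- int (p * q))
                        else chi d (- int ((d + 1) div 2) * int p * int q))"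

definition weyl1 :: "nat \<Rightarrow> nat \<Rightarrow> nat \<Rightarrow> complex mat" where
  "weyl1 d p q = mat d d (\<lambda>(r,c).
      if r = (c + q) mod d then weyl_phase d p q * chi d (int p * int r) else 0)"

text \<open>n-qudit Weyl operator w(p,q) = tensor product over qudits k < n of w(p_k,q_k);
  p, q < d^n encode vectors in Z_d^n.\<close>
definition weyl :: "nat \<Rightarrow> nat \<Rightarrow> nat \<Rightarrow> nat \<Rightarrow> complex mat" where
  "weyl d n p q = mat (d^n) (d^n) (\<lambda>(r,c).
      \<Prod>k<n. weyl1 d (digit d k p) (digit d k q) $$ (digit d k r, digit d k c))"

definition vadd :: "nat \<Rightarrow> nat \<Rightarrow> nat \<Rightarrow> nat \<Rightarrow> nat" where
  "vadd d n a b = enc d n (\<lambda>k. int (digit d k a) + int (digit d k b))"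

text \<open>A pure stabilizer state: a common eigenvector of an abelian group of d^n Weyl
  operators (up to phases), i.e. of all w(p,q) with (p,q) ranging over a set S of
  d^n labels that is closed under addition in Z_d^{2n}, contains 0, and whose Weyl
  operators pairwise commute.\<close>
definition stabilizer_state :: "nat \<Rightarrow> nat \<Rightarrow> complex vec \<Rightarrow> bool" where
  "stabilizer_state d n \<psi> \<longleftrightarrow> \<psi> \<in> carrier_vec (d^n) \<and> \<psi> \<noteq> 0\<^sub>v (d^n) \<and>
     (\<exists>S. S \<subseteq> {0..<d^n} \<times> {0..<d^n} \<and> card S = d ^ n \<and> (0,0) \<in> S \<and>
        (\<forall>(p,q)\<in>S. \<forall>(p',q')\<in>S. (vadd d n p p', vadd d n q q') \<in> S \<and>
             weyl d n p q * weyl d n p' q' = weyl d n p' q' * weyl d n p q) \<and>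
        (\<forall>(p,q)\<in>S. \<exists>c. weyl d n p q *\<^sub>v \<psi> = c \<cdot>\<^sub>v \<psi>))"

end

(* With D = d^n and cf A (p,q) = tr (Z^p X^q A), Parseval gives sum |cf A|^2 = D tr A^2, and cf is
   multiplicative under the convolution:
     cf (rho [x] sigma) (p,q) = cf rho (N g11 p, g00 q) * cf sigma (-N g10 p, g01 q),
   with all four coefficients invertible mod d.

   If the capacity is n log d, some inputs have outputs of entropy, hence of impurity
   1 - tr (E rho)^2 <= H (E rho), arbitrarily close to 0. Writing r = |cf rho|^2 and s = |cf sigma|^2,
   the bound s (1 - s) <= r (1 - s) + s (1 - r) then forces s to take only the values 0 and 1.
   The D labels with s = 1 are those whose Weyl operators have sigma as an eigenvector, and they form
   the stabilizer group.

   Conversely, rescaling the labels of the stabilizer group of sigma preserves commutation, so there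
   is a common eigenvector phi of the rescaled operators. All Weyl translates of phi have pure
   outputs, and their uniform mixture has the maximally mixed output. *)

theory Submission
  imports Defs "Jordan_Normal_Form.Schur_Decomposition"
begin

section \<open>Entropy of density operators\<close>

text \<open>The supremum that defines the capacity is not known to be attained, so the forward
  direction has no exactly pure output to work with. The argument must be quantitative, and purity
  replaces entropy because Parseval turns it into a sum over labels.

  The bound on s (1 - s) is modelled on the extreme case. All r and s lie in [0,1], the r and the s
  each add up to at most D, and the products r s, each r taken at the label paired with that of s,
  add up to D times the output purity. Were that purity 1, the sum of r + s - 2 r s = r (1 - s) + s
  (1 - r) would vanish. The lower bound s (1 - s) involves sigma alone, so it can be driven to zero
  while the input changes.

  Positivity of G makes every relabelling a bijection, so that sums over labels survive it. Phases
  of Weyl operators never matter: neither being an eigenvector nor commuting depends on nonzero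
  scalar factors, so d = 2 and odd d are treated alike.\<close>

lemma order_prod_list_linear:
  "Polynomial.order x (\<Prod>a\<leftarrow>as. [:- a, 1:]) = count_list as (x :: 'a :: field)"
proof (induction as)
  case (Cons a as)
  have "(\<Prod>a\<leftarrow>as. [:- a, 1:]) \<noteq> 0" by (auto simp: prod_list_zero_iff)
  then have "[:- a, 1:] * (\<Prod>a\<leftarrow>as. [:- a, 1:]) \<noteq> 0" by (simp del: mult_pCons_left)
  then have "Polynomial.order x ([:- a, 1:] * (\<Prod>a\<leftarrow>as. [:- a, 1:])) = Polynomial.order x [:- a, 1:] + count_list as x"
    using Cons by (simp add: order_mult del: mult_pCons_left)
  moreover have "Polynomial.order x [:- a, 1:] = (if a = x then 1 else 0)"
    using order_power_n_n[of x 1] by (auto intro!: order_0I)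
  ultimately show ?case by simp
qed (simp add: order_0I)

text \<open>The entropy is a sum over distinct roots weighted by \<open>order\<close>. A list with
  repetitions, as supplied by a factorised characteristic polynomial, is easier to estimate term by
  term.\<close>

lemma sum_roots_order_eq_sum_list:
  fixes g :: "'a :: field \<Rightarrow> real"
  assumes "p = (\<Prod>a\<leftarrow>as. [:- a, 1:])"
  shows "(\<Sum>x \<in> {x. poly p x = 0}. real (Polynomial.order x p) * g x) = (\<Sum>a\<leftarrow>as. g a)"
proof -
  have roots: "{x. poly p x = 0} = set as"
    unfolding assms by (induction as) auto
  have "(\<Sum>a\<leftarrow>as. g a) = (\<Sum>x\<in>set as. real (count_list as x) * g x)"
  proof (induction as)
    case (Cons a as)
    have "(\<Sum>x\<in>set (a # as). real (count_list (a # as) x) * g x)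
        = (\<Sum>x\<in>set (a # as). (if x = a then g x else 0) + real (count_list as x) * g x)"
      by (intro sum.cong) (auto simp: algebra_simps)
    also have "\<dots> = g a + (\<Sum>x\<in>set (a # as). real (count_list as x) * g x)"
      by (subst sum.distrib) (simp add: sum.delta)
    also have "(\<Sum>x\<in>set (a # as). real (count_list as x) * g x)
        = (\<Sum>x\<in>set as. real (count_list as x) * g x)"
      by (intro sum.mono_neutral_right) (auto simp: count_list_0_iff)
    finally show ?case using Cons by simp
  qed simp
  then show ?thesis unfolding roots by (simp add: assms order_prod_list_linear)
qed

lemma mult_mat_entry:
  assumes "A \<in> carrier_mat l m" "B \<in> carrier_mat m k" "i < l" "j < k"
  shows "(A * B) $$ (i,j) = (\<Sum>t<m. A $$ (i,t) * B $$ (t,j))"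
  using assms by (auto simp: scalar_prod_def atLeast0LessThan intro!: sum.cong)

text \<open>Cyclicity of the trace: \<open>P * B * Q\<close> and \<open>Q * (P * B)\<close> have the
  same diagonal sum.\<close>

lemma trace_similar_mat:
  fixes A :: "'a :: comm_ring_1 mat"
  assumes A: "A \<in> carrier_mat m m" and sim: "similar_mat_wit A B P Q"
  shows "(\<Sum>i<m. A $$ (i,i)) = (\<Sum>i<m. B $$ (i,i))"
proof -
  note s = similar_mat_witD2[OF A sim]
  have "(\<Sum>i<m. A $$ (i,i)) = (\<Sum>i<m. \<Sum>t<m. (P * B) $$ (i,t) * Q $$ (t,i))"
    unfolding s(3) using s by (intro sum.cong refl mult_mat_entry[of _ m m _ m]) auto
  also have "\<dots> = (\<Sum>t<m. \<Sum>i<m. Q $$ (t,i) * (P * B) $$ (i,t))"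
    by (subst sum.swap) (simp add: mult.commute)
  also have "\<dots> = (\<Sum>t<m. (Q * (P * B)) $$ (t,t))"
    using s by (intro sum.cong refl mult_mat_entry[of _ m m _ m, symmetric]) auto
  also have "Q * (P * B) = B"
    using s by (metis assoc_mult_mat left_mult_one_mat)
  finally show ?thesis .
qed

lemma cscalar_mult_mat_vec:
  assumes "A \<in> carrier_mat m m" "v \<in> carrier_vec m"
  shows "conjugate v \<bullet> (A *\<^sub>v v) = (\<Sum>i<m. \<Sum>j<m. cnj (v $ i) * A $$ (i,j) * v $ j)"
  using assms by (auto simp: scalar_prod_def atLeast0LessThan sum_distrib_left mult.assoc intro!: sum.cong)

lemma hermitian_entry:
  assumes "adj A = A" "A \<in> carrier_mat m m" "i < m" "j < m"
  shows "A $$ (j,i) = cnj (A $$ (i,j))"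
proof -
  have "adj A $$ (j,i) = cnj (A $$ (i,j))" using assms(2-4) by (auto simp: adj_def)
  then show ?thesis using assms(1) by simp
qed

text \<open>At an eigenvector \<open>v\<close> the quadratic form is \<open>x\<close> times the
  squared norm \<open>s\<close> of \<open>v\<close>. Hermiticity makes it real, positivity makes it
  nonnegative, and \<open>s > 0\<close> can be divided out.\<close>

lemma density_op_eigenvalue:
  assumes A: "density_op m A" and ev: "eigenvalue A x"
  shows "x = of_real (Re x)" "0 \<le> Re x"
proof -
  have c: "A \<in> carrier_mat m m" and h: "adj A = A"
    and pos: "\<And>v. v \<in> carrier_vec m \<Longrightarrow> 0 \<le> Re (conjugate v \<bullet> (A *\<^sub>v v))"
    using A by (auto simp: density_op_def)
  obtain v where v: "v \<in> carrier_vec m" "v \<noteq> 0\<^sub>v m" "A *\<^sub>v v = x \<cdot>\<^sub>v v"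
    using ev c by (auto simp: eigenvalue_def eigenvector_def)
  define s where "s = (\<Sum>i<m. (cmod (v $ i))\<^sup>2)"
  have "s \<noteq> 0"
  proof
    assume "s = 0"
    then have "\<forall>i<m. v $ i = 0" unfolding s_def by (subst (asm) sum_nonneg_eq_0_iff) auto
    then show False using v by (auto intro!: eq_vecI)
  qed
  moreover have "s \<ge> 0" unfolding s_def by (intro sum_nonneg) auto
  ultimately have s: "s > 0" by simp
  have q: "conjugate v \<bullet> (A *\<^sub>v v) = x * of_real s"
    using v(1) unfolding v(3) s_def
    by (auto simp: scalar_prod_def atLeast0LessThan sum_distrib_left complex_norm_square mult_ac
        simp del: of_real_power intro!: sum.cong)
  have "cnj (conjugate v \<bullet> (A *\<^sub>v v)) = conjugate v \<bullet> (A *\<^sub>v v)"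
  proof -
    have "cnj (conjugate v \<bullet> (A *\<^sub>v v)) = (\<Sum>i<m. \<Sum>j<m. cnj (v $ j) * A $$ (j,i) * v $ i)"
      unfolding cscalar_mult_mat_vec[OF c v(1)] cnj_sum
      by (intro sum.cong refl) (auto simp: hermitian_entry[OF h c, symmetric] mult_ac)
    then show ?thesis unfolding cscalar_mult_mat_vec[OF c v(1)] by (subst sum.swap)
  qed
  then have "cnj x * of_real s = x * of_real s" unfolding q by simp
  then have "cnj x = x" using s by simp
  then have "Im x = 0" by (simp add: complex_eq_iff)
  then show r: "x = of_real (Re x)" by (simp add: complex_eq_iff)
  have "0 \<le> Re (x * of_real s)" using pos[OF v(1)] q by simp
  then show "0 \<le> Re x" using s by (simp add: zero_le_mult_iff)
qed

text \<open>For Hermitian \<open>A\<close> this is the trace of \<open>A * A\<close>. The squared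
  Hilbert-Schmidt norm is the form to which Parseval applies directly.\<close>

definition purity :: "nat \<Rightarrow> complex mat \<Rightarrow> real" where
  "purity m A = (\<Sum>i<m. \<Sum>j<m. (cmod (A $$ (i,j)))\<^sup>2)"

text \<open>Triangularisation is enough: it gives the eigenvalues as a list with the right trace and
  the right trace of the square, so no orthonormal eigenbasis is needed.\<close>

lemma density_op_spectrum:
  assumes A: "density_op m A"
  obtains es :: "real list" where
    "length es = m" "\<forall>e\<in>set es. 0 \<le> e \<and> e \<le> 1" "sum_list es = 1"
    "(\<Sum>e\<leftarrow>es. e\<^sup>2) = purity m A"
    "vn_entropy A = - (\<Sum>e\<leftarrow>es. e * ln e)"
proof -
  have c: "A \<in> carrier_mat m m" and h: "adj A = A" and tr: "(\<Sum>i<m. A $$ (i,i)) = 1"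
    using A by (auto simp: density_op_def)
  obtain as where as: "char_poly A = (\<Prod>a\<leftarrow>as. [:- a, 1:])" "length as = m"
    using char_poly_factorized[OF c] by auto
  obtain B P Q where "schur_decomposition A as = (B,P,Q)"
    by (cases "schur_decomposition A as") auto
  from schur_decomposition[OF c as(1) this]
  have sim: "similar_mat_wit A B P Q" and ut: "upper_triangular B" and diag: "diag_mat B = as"
    by auto
  note s = similar_mat_witD2[OF c sim]
  define es where "es = map Re as"
  have asD: "as = map (\<lambda>i. B $$ (i,i)) [0..<m]" using diag s(5) by (auto simp: diag_mat_def)
  have ev: "x = of_real (Re x) \<and> 0 \<le> Re x" if "x \<in> set as" for x
  proof -
    have "poly (char_poly A) x = 0" unfolding as(1) using that by (induction as) auto
    then have "eigenvalue A x" using eigenvalue_root_char_poly[OF c] by simp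
    from density_op_eigenvalue[OF A this] show ?thesis by blast
  qed
  have asE: "as = map of_real es" unfolding es_def using ev by (simp add: map_idI)
  have nonneg: "0 \<le> e" if "e \<in> set es" for e using that ev by (auto simp: es_def)
  have suml: "sum_list (map f [0..<m]) = (\<Sum>i<m. f i)" for f :: "nat \<Rightarrow> complex"
    by (simp add: interv_sum_list_conv_sum_set_nat atLeast0LessThan)
  have "complex_of_real (sum_list es) = sum_list as"
    unfolding asE by (induction es) auto
  also have "\<dots> = (\<Sum>i<m. B $$ (i,i))" unfolding asD suml ..
  also have "\<dots> = 1" using trace_similar_mat[OF c sim] tr by simp
  finally have sum1: "sum_list es = 1" by (simp add: of_real_eq_1_iff)
  have AA: "A ^\<^sub>m 2 = A * A" and BB: "B ^\<^sub>m 2 = B * B"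
    using c s(5) by (auto simp: numeral_2_eq_2)
  have sim2: "similar_mat_wit (A * A) (B * B) P Q"
    using similar_mat_wit_pow[OF sim, of 2] unfolding AA BB .
  have "complex_of_real (\<Sum>e\<leftarrow>es. e\<^sup>2) = (\<Sum>a\<leftarrow>as. a\<^sup>2)"
    unfolding asE by (induction es) auto
  also have "\<dots> = (\<Sum>i<m. (B $$ (i,i))\<^sup>2)" unfolding asD by (simp add: suml o_def)
  also have "\<dots> = (\<Sum>i<m. (B * B) $$ (i,i))"
  proof (intro sum.cong refl)
    fix i assume "i \<in> {..<m}"
    then have i: "i < m" by simp
    have "(B * B) $$ (i,i) = (\<Sum>t<m. B $$ (i,t) * B $$ (t,i))"
      by (rule mult_mat_entry[OF s(5,5) i i])
    also have "\<dots> = (\<Sum>t<m. if t = i then (B $$ (i,i))\<^sup>2 else 0)"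
    proof (intro sum.cong refl)
      fix t assume t: "t \<in> {..<m}"
      \<comment> \<open>For \<open>t \<noteq> i\<close> one of the two factors lies below the
        diagonal.\<close>
      show "B $$ (i,t) * B $$ (t,i) = (if t = i then (B $$ (i,i))\<^sup>2 else 0)"
        using upper_triangularD[OF ut, of t i] upper_triangularD[OF ut, of i t] i t s(5)
        by (cases t i rule: linorder_cases) (auto simp: power2_eq_square)
    qed
    also have "\<dots> = (B $$ (i,i))\<^sup>2" using i by simp
    finally show "(B $$ (i,i))\<^sup>2 = (B * B) $$ (i,i)" ..
  qed
  also have "\<dots> = (\<Sum>i<m. (A * A) $$ (i,i))"
    using trace_similar_mat[OF mult_carrier_mat[OF c c] sim2] by (rule sym)
  also have "\<dots> = (\<Sum>i<m. \<Sum>j<m. of_real ((cmod (A $$ (i,j)))\<^sup>2))"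
  proof (intro sum.cong refl)
    fix i assume i: "i \<in> {..<m}"
    then have "(A * A) $$ (i,i) = (\<Sum>j<m. A $$ (i,j) * A $$ (j,i))"
      by (intro mult_mat_entry[OF c c]) auto
    also have "\<dots> = (\<Sum>j<m. of_real ((cmod (A $$ (i,j)))\<^sup>2))"
      using i hermitian_entry[OF h c, of i]
      by (intro sum.cong refl) (simp only: complex_norm_square lessThan_iff)
    finally show "(A * A) $$ (i,i) = (\<Sum>j<m. of_real ((cmod (A $$ (i,j)))\<^sup>2))" .
  qed
  also have "\<dots> = of_real (\<Sum>i<m. \<Sum>j<m. (cmod (A $$ (i,j)))\<^sup>2)" by simp
  finally have sq: "(\<Sum>e\<leftarrow>es. e\<^sup>2) = purity m A"
    unfolding purity_def of_real_eq_iff .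
  have ent: "vn_entropy A = - (\<Sum>e\<leftarrow>es. e * ln e)"
    unfolding vn_entropy_def using sum_roots_order_eq_sum_list[OF as(1), of "\<lambda>x. Re x * ln (Re x)"]
    by (simp add: es_def o_def)
  have "e \<le> 1" if "e \<in> set es" for e
    using member_le_sum_list[OF that] nonneg sum1 by simp
  with that[of es] show ?thesis using as(2) nonneg sum1 sq ent by (auto simp: es_def)
qed

lemma purity_le_1:
  assumes "density_op m A"
  shows "purity m A \<le> 1"
proof -
  obtain es where es: "length es = m" "\<forall>e\<in>set es. 0 \<le> e \<and> e \<le> 1" "sum_list es = 1"
    "(\<Sum>e\<leftarrow>es. e\<^sup>2) = purity m A" "vn_entropy A = - (\<Sum>e\<leftarrow>es. e * ln e)"
    by (rule density_op_spectrum[OF assms])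
  have "(\<Sum>e\<leftarrow>es. e\<^sup>2) \<le> (\<Sum>e\<leftarrow>es. e)"
    by (intro sum_list_mono) (use es(2) in \<open>auto simp: power2_eq_square mult_left_le\<close>)
  then show ?thesis using es by simp
qed

text \<open>Termwise, ln e <= e - 1 gives - e ln e >= e - e^2, and the right-hand sides add up to
  one minus the purity.\<close>

lemma vn_entropy_ge_1_minus_purity:
  assumes "density_op m A"
  shows "1 - purity m A \<le> vn_entropy A"
proof -
  obtain es where es: "length es = m" "\<forall>e\<in>set es. 0 \<le> e \<and> e \<le> 1" "sum_list es = 1"
    "(\<Sum>e\<leftarrow>es. e\<^sup>2) = purity m A" "vn_entropy A = - (\<Sum>e\<leftarrow>es. e * ln e)"
    by (rule density_op_spectrum[OF assms])
  have "(\<Sum>e\<leftarrow>es. e * ln e) \<le> (\<Sum>e\<leftarrow>es. e\<^sup>2 - e)"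
  proof (intro sum_list_mono)
    fix e assume "e \<in> set es"
    then have e: "0 \<le> e" using es(2) by auto
    show "e * ln e \<le> e\<^sup>2 - e"
    proof (cases "e = 0")
      case False
      then have "e * ln e \<le> e * (e - 1)" using e by (intro mult_left_mono ln_le_minus_one) auto
      then show ?thesis by (simp add: power2_eq_square algebra_simps)
    qed simp
  qed
  also have "\<dots> = purity m A - 1" using es by (simp add: sum_list_subtractf)
  finally show ?thesis using es(5) by simp
qed

lemma vn_entropy_nonneg:
  assumes "density_op m A"
  shows "0 \<le> vn_entropy A"
  using purity_le_1[OF assms] vn_entropy_ge_1_minus_purity[OF assms] by simp

text \<open>The nonnegative numbers e - e^2 add up to 1 - 1 = 0, so every eigenvalue is 0 or 1, and
  e ln e vanishes at both.\<close>

lemma vn_entropy_pure: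
  assumes "density_op m A" "purity m A = 1"
  shows "vn_entropy A = 0"
proof -
  obtain es where es: "length es = m" "\<forall>e\<in>set es. 0 \<le> e \<and> e \<le> 1" "sum_list es = 1"
    "(\<Sum>e\<leftarrow>es. e\<^sup>2) = purity m A" "vn_entropy A = - (\<Sum>e\<leftarrow>es. e * ln e)"
    by (rule density_op_spectrum[OF assms(1)])
  have "(\<Sum>e\<leftarrow>es. e - e\<^sup>2) = 0" using es assms(2) by (simp add: sum_list_subtractf)
  moreover have "\<And>x. x \<in> set (map (\<lambda>e. e - e\<^sup>2) es) \<Longrightarrow> 0 \<le> x"
    using es(2) by (auto simp: power2_eq_square mult_left_le)
  ultimately have "\<forall>x \<in> set (map (\<lambda>e. e - e\<^sup>2) es). x = 0"
    using sum_list_nonneg_eq_0_iff by blast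
  then have "e * ln e = 0" if "e \<in> set es" for e using that by (auto simp: power2_eq_square)
  then have "map (\<lambda>e. e * ln e) es = map (\<lambda>e. 0) es" by (intro map_cong) auto
  then have "(\<Sum>e\<leftarrow>es. e * ln e) = (\<Sum>e\<leftarrow>es. 0)" by (rule arg_cong)
  then show ?thesis unfolding es(5) by simp
qed

text \<open>Gibbs' inequality against the uniform distribution: ln x <= x - 1 at x = 1 / (e m),
  multiplied by e and summed over the spectrum.\<close>

lemma vn_entropy_le_ln_dim:
  assumes "density_op m A"
  shows "vn_entropy A \<le> ln (real m)"
proof -
  obtain es where es: "length es = m" "\<forall>e\<in>set es. 0 \<le> e \<and> e \<le> 1" "sum_list es = 1"
    "(\<Sum>e\<leftarrow>es. e\<^sup>2) = purity m A" "vn_entropy A = - (\<Sum>e\<leftarrow>es. e * ln e)"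
    by (rule density_op_spectrum[OF assms])
  have m: "m > 0" using es(1,3) by (cases es) auto
  have "(\<Sum>e\<leftarrow>es. - (e * ln e)) \<le> (\<Sum>e\<leftarrow>es. 1 / real m - e + e * ln (real m))"
  proof (intro sum_list_mono)
    fix e assume "e \<in> set es"
    then have e: "0 \<le> e" using es(2) by auto
    show "- (e * ln e) \<le> 1 / real m - e + e * ln (real m)"
    proof (cases "e = 0")
      case False
      then have pos: "e > 0" using e by simp
      have "e * ln (1 / (e * m)) \<le> e * (1 / (e * m) - 1)"
        using pos m by (intro mult_left_mono ln_le_minus_one) auto
      also have "\<dots> = 1 / m - e" using pos by (simp add: field_simps)
      also have "ln (1 / (e * m)) = - ln e - ln m" using pos m by (simp add: ln_div ln_mult)
      finally show ?thesis by (simp add: algebra_simps)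
    qed simp
  qed
  also have "\<dots> = real m * (1 / real m) - 1 + ln (real m)"
  proof -
    have "(\<Sum>e\<leftarrow>xs. 1 / real m - e + e * ln (real m))
      = real (length xs) * (1 / real m) - sum_list xs + sum_list xs * ln (real m)" for xs
      by (induction xs) (auto simp: algebra_simps add_divide_distrib)
    then show ?thesis using es by simp
  qed
  also have "\<dots> = ln (real m)" using m by simp
  finally show ?thesis using es(5) by (simp add: uminus_sum_list_map o_def)
qed

lemma vn_entropy_maximally_mixed:
  assumes "m > 0"
  shows "vn_entropy (mat m m (\<lambda>(i,j). if i = j then of_real (1 / real m) else 0)) = ln (real m)"
proof -
  let ?A = "mat m m (\<lambda>(i,j). if i = j then complex_of_real (1 / real m) else 0)"
  have "char_poly ?A = (\<Prod>a\<leftarrow>diag_mat ?A. [:- a, 1:])"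
    by (rule char_poly_upper_triangular[of _ m]) (auto intro!: upper_triangularI)
  moreover have "diag_mat ?A = map (\<lambda>i. of_real (1 / real m)) [0..<m]"
    by (auto simp: diag_mat_def)
  ultimately have "char_poly ?A = (\<Prod>a\<leftarrow>map (\<lambda>i. of_real (1 / real m)) [0..<m]. [:- a, 1:])"
    by simp
  note sum_roots_order_eq_sum_list[OF this, of "\<lambda>x. Re x * ln (Re x)"]
  then have "vn_entropy ?A = - (\<Sum>i\<leftarrow>[0..<m]. (1 / real m) * ln (1 / real m))"
    unfolding vn_entropy_def by (simp add: o_def)
  also have "\<dots> = ln (real m)" using assms by (simp add: ln_div sum_list_triv)
  finally show ?thesis .
qed

section \<open>Arithmetic of qudit labels and characteristic functions\<close>

lemma digit_less: "d > 0 \<Longrightarrow> digit d k i < d"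
  by (simp add: digit_def)

lemma enc_less: "d > 0 \<Longrightarrow> enc d n f < d ^ n"
proof (induction n)
  case (Suc n)
  have "nat (f n mod int d) \<le> d - 1" using Suc.prems by (simp add: nat_le_iff of_nat_diff)
  then have "nat (f n mod int d) * d ^ n \<le> (d - 1) * d ^ n" by (rule mult_right_mono) simp
  moreover have "(d - 1) * d ^ n + d ^ n = d ^ Suc n" using Suc.prems
    by (cases d) auto
  moreover have "enc d (Suc n) f = enc d n f + nat (f n mod int d) * d ^ n" by (simp add: enc_def)
  ultimately show ?case using Suc by linarith
qed (simp add: enc_def)

lemma digit_enc:
  assumes d: "d > 0" and "k < n"
  shows "digit d k (enc d n f) = nat (f k mod int d)"
  using assms(2)
proof (induction n)
  case (Suc n)
  have eq: "enc d (Suc n) f = enc d n f + nat (f n mod int d) * d ^ n" by (simp add: enc_def)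
  show ?case
  proof (cases "k = n")
    case True
    have "nat (f n mod int d) < d" using d by (simp add: nat_less_iff)
    then show ?thesis using True d enc_less[OF d, of n f] by (simp add: eq digit_def)
  next
    case False
    then have k: "k < n" using Suc.prems by simp
    \<comment> \<open>After division by \<open>d ^ k\<close> the new top digit still carries a
      factor \<open>d\<close>, which the reduction mod \<open>d\<close> removes; \<open>j\<close> is
      the number of further factors.\<close>
    define j where "j = n - k - 1"
    have "n = k + Suc j" using k by (simp add: j_def)
    then have n: "d ^ n = d ^ k * (d * d ^ j)" by (simp add: power_add)
    have "(enc d n f + nat (f n mod int d) * d ^ n) div d ^ k
        = enc d n f div d ^ k + d * (d ^ j * nat (f n mod int d))"
      using d div_mult_self2[of "d ^ k" "enc d n f" "d * (d ^ j * nat (f n mod int d))"]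
      by (simp add: n mult_ac)
    then show ?thesis using Suc.IH[OF k] by (simp add: eq digit_def)
  qed
qed simp

lemma enc_digit: "enc d n (\<lambda>k. int (digit d k i)) = i mod d ^ n"
proof (induction n)
  case (Suc n)
  have "enc d (Suc n) (\<lambda>k. int (digit d k i)) = i mod d ^ n + digit d n i * d ^ n"
    using Suc by (simp add: enc_def digit_def flip: zmod_int)
  also have "\<dots> = i mod (d ^ n * d)" by (simp add: mod_mult2_eq digit_def)
  finally show ?case by (simp add: mult.commute)
qed (simp add: enc_def)

lemma enc_cong: "(\<And>k. k < n \<Longrightarrow> f k mod int d = g k mod int d) \<Longrightarrow> enc d n f = enc d n g"
  by (simp add: enc_def)

section \<open>Characters of Z_d\<close>

lemma chi_add: "chi d (x + y) = chi d x * chi d y"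
  by (simp add: chi_def cis_mult ring_distribs add_divide_distrib)

lemma chi_diff: "chi d (x - y) = chi d x * chi d (- y)"
  using chi_add[of d x "- y"] by simp

lemma chi_0 [simp]: "chi d 0 = 1"
  by (simp add: chi_def)

lemma cnj_chi: "cnj (chi d x) = chi d (- x)"
  by (simp add: chi_def cis_cnj)

lemma norm_chi [simp]: "cmod (chi d x) = 1"
  by (simp add: chi_def)

lemma chi_nonzero [simp]: "chi d x \<noteq> 0"
  using norm_chi[of d x] by fastforce

lemma chi_of_nat_mult: "chi d (int k * x) = chi d x ^ k"
  by (induction k) (simp_all add: ring_distribs chi_add)

lemma chi_eq_1_iff:
  assumes "d > 0"
  shows "chi d x = 1 \<longleftrightarrow> int d dvd x"
proof
  assume "chi d x = 1"
  then have "cos (2 * pi * of_int x / of_nat d) = 1"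
    by (metis chi_def cis.sel(1) one_complex.sel(1))
  then obtain m :: int where "2 * pi * of_int x / of_nat d = of_int m * 2 * pi"
    using cos_one_2pi_int by blast
  then have "real_of_int x = of_int (m * int d)" using assms by (simp add: field_simps)
  then have "x = m * int d" using of_int_eq_iff by blast
  then show "int d dvd x" by simp
next
  assume "int d dvd x"
  then obtain m where "x = int d * m" by auto
  then have "2 * pi * of_int x / of_nat d = 2 * pi * of_int m" using assms by simp
  then show "chi d x = 1" unfolding chi_def by (simp add: cis_multiple_2pi)
qed

lemma chi_cong:
  assumes "d > 0" "[x = y] (mod int d)"
  shows "chi d x = chi d y"
proof -
  have "chi d (x - y) = 1" using assms by (simp add: chi_eq_1_iff cong_iff_dvd_diff)
  then show ?thesis using chi_add[of d "x - y" y] by simp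
qed

section \<open>Linear algebra over Z_d on encoded labels\<close>

locale qudits =
  fixes d n :: nat
  assumes prime_d: "prime d"
begin

abbreviation D where "D \<equiv> d ^ n"

text \<open>One operation covers translations (\<open>lc 1 r (- 1) q\<close> is r - q), dilations
  (\<open>smul\<close>) and the coordinate maps of the key unitary, so a few composition laws serve
  for all of them.\<close>

definition lc :: "int \<Rightarrow> nat \<Rightarrow> int \<Rightarrow> nat \<Rightarrow> nat" where
  "lc \<alpha> a \<beta> b = enc d n (\<lambda>k. \<alpha> * int (digit d k a) + \<beta> * int (digit d k b))"

abbreviation smul where "smul \<alpha> a \<equiv> lc \<alpha> a 0 0"

text \<open>The value is an integer built from digit representatives and is bilinear only mod
  \<open>d\<close>. Hence the congruences below; \<open>chi d\<close> does not see the
  difference.\<close>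

definition dot :: "nat \<Rightarrow> nat \<Rightarrow> int" where
  "dot p r = (\<Sum>k<n. int (digit d k p) * int (digit d k r))"

lemma d_pos [simp]: "d > 0" using prime_d by (simp add: prime_gt_0_nat)

lemma D_pos [simp]: "D > 0" by simp

lemma vadd_lc: "vadd d n a b = lc 1 a 1 b"
  by (simp add: vadd_def lc_def)

lemma lc_less [simp]: "lc \<alpha> a \<beta> b < D"
  by (simp add: lc_def enc_less)

lemma digit_lc:
  "k < n \<Longrightarrow> int (digit d k (lc \<alpha> a \<beta> b)) = (\<alpha> * int (digit d k a) + \<beta> * int (digit d k b)) mod int d"
  by (simp add: lc_def digit_enc)

lemma lc_cong: "[\<alpha> = \<alpha>'] (mod int d) \<Longrightarrow> [\<beta> = \<beta>'] (mod int d) \<Longrightarrow> lc \<alpha> a \<beta> b = lc \<alpha>' a \<beta>' b"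
  unfolding lc_def by (rule enc_cong) (metis cong_def cong_add cong_mult cong_refl)

lemma cong_digit_lc:
  "k < n \<Longrightarrow> [int (digit d k (lc \<alpha> a \<beta> b)) = \<alpha> * int (digit d k a) + \<beta> * int (digit d k b)] (mod int d)"
  by (simp add: digit_lc cong_def)

lemma lc_lc: "lc \<alpha> (lc \<alpha>1 a \<beta>1 b) \<beta> (lc \<alpha>2 a \<beta>2 b) = lc (\<alpha> * \<alpha>1 + \<beta> * \<alpha>2) a (\<alpha> * \<beta>1 + \<beta> * \<beta>2) b"
  unfolding lc_def[of \<alpha>] lc_def[of "\<alpha> * \<alpha>1 + \<beta> * \<alpha>2"]
proof (rule enc_cong)
  fix k assume "k < n"
  note c = cong_digit_lc[OF this]
  show "(\<alpha> * int (digit d k (lc \<alpha>1 a \<beta>1 b)) + \<beta> * int (digit d k (lc \<alpha>2 a \<beta>2 b))) mod int d =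
    ((\<alpha> * \<alpha>1 + \<beta> * \<alpha>2) * int (digit d k a) + (\<alpha> * \<beta>1 + \<beta> * \<beta>2) * int (digit d k b)) mod int d"
    using cong_add[OF cong_scalar_left[OF c[of \<alpha>1 a \<beta>1 b], of \<alpha>]
        cong_scalar_left[OF c[of \<alpha>2 a \<beta>2 b], of \<beta>]]
    by (simp add: cong_def algebra_simps)
qed

text \<open>This is not an instance of \<open>lc_lc\<close>, which would need \<open>b\<close> in
  the form \<open>lc 0 a 1 b\<close>; the two agree only for \<open>b < D\<close>.\<close>

lemma lc_lc_left: "lc \<alpha> (lc \<alpha>1 a \<beta>1 b) \<beta> b = lc (\<alpha> * \<alpha>1) a (\<alpha> * \<beta>1 + \<beta>) b"
  unfolding lc_def[of \<alpha>] lc_def[of "\<alpha> * \<alpha>1"]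
proof (rule enc_cong)
  fix k assume "k < n"
  from cong_add[OF cong_scalar_left[OF cong_digit_lc[OF this, of \<alpha>1 a \<beta>1 b], of \<alpha>]
      cong_refl[of "\<beta> * int (digit d k b)"]]
  show "(\<alpha> * int (digit d k (lc \<alpha>1 a \<beta>1 b)) + \<beta> * int (digit d k b)) mod int d =
    (\<alpha> * \<alpha>1 * int (digit d k a) + (\<alpha> * \<beta>1 + \<beta>) * int (digit d k b)) mod int d"
    by (simp add: cong_def algebra_simps)
qed

lemma lc_commute: "lc \<alpha> a \<beta> b = lc \<beta> b \<alpha> a"
  by (simp add: lc_def add.commute)

lemma lc_1_0: "a < D \<Longrightarrow> lc 1 a 0 b = a"
  by (simp add: lc_def enc_digit)

lemma lc_0_1: "b < D \<Longrightarrow> lc 0 a 1 b = b"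
  by (simp add: lc_def enc_digit)

lemma dot_commute: "dot p r = dot r p"
  by (simp add: dot_def mult.commute)

lemma dot_lc: "[dot p (lc \<alpha> a \<beta> b) = \<alpha> * dot p a + \<beta> * dot p b] (mod int d)"
proof -
  have "[dot p (lc \<alpha> a \<beta> b)
      = (\<Sum>k<n. int (digit d k p) * (\<alpha> * int (digit d k a) + \<beta> * int (digit d k b)))] (mod int d)"
    unfolding dot_def by (intro cong_sum cong_mult cong_refl) (simp add: digit_lc cong_def)
  also have "(\<Sum>k<n. int (digit d k p) * (\<alpha> * int (digit d k a) + \<beta> * int (digit d k b)))
      = \<alpha> * dot p a + \<beta> * dot p b"
    by (simp add: dot_def sum_distrib_left sum.distrib ring_distribs mult_ac)
  finally show ?thesis .
qed

lemma dot_lc_left: "[dot (lc \<alpha> a \<beta> b) p = \<alpha> * dot a p + \<beta> * dot b p] (mod int d)"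
  using dot_lc[of p \<alpha> a \<beta> b] unfolding dot_commute[of p] .

lemma chi_dot_lc: "chi d (dot p (lc \<alpha> a \<beta> b)) = chi d (\<alpha> * dot p a + \<beta> * dot p b)"
  by (intro chi_cong dot_lc) simp

text \<open>As \<open>d\<close> is prime, a nonzero residue is coprime to \<open>d\<close> and hence
  invertible.\<close>

lemma unit_inverse:
  assumes "\<not> [\<alpha> = 0] (mod int d)"
  obtains \<gamma> where "[\<gamma> * \<alpha> = 1] (mod int d)" "\<not> [\<gamma> = 0] (mod int d)"
proof -
  have p: "prime (int d)" using prime_d by simp
  have "coprime \<alpha> (int d)"
    using prime_imp_coprime[OF p, of \<alpha>] assms by (auto simp: cong_0_iff coprime_commute)
  then obtain \<gamma> where g: "[\<alpha> * \<gamma> = 1] (mod int d)" using cong_solve_coprime_int by blast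
  have "\<not> [\<gamma> = 0] (mod int d)"
  proof
    assume "[\<gamma> = 0] (mod int d)"
    then have "[\<alpha> * \<gamma> = \<alpha> * 0] (mod int d)" by (rule cong_scalar_left)
    with g have "[1 = 0] (mod int d)" by (metis cong_sym cong_trans mult_zero_right)
    then show False using prime_gt_1_int[OF p] by (auto simp: cong_0_iff)
  qed
  with g that[of \<gamma>] show ?thesis by (simp add: mult.commute)
qed

lemma unit_mult:
  "\<not> [\<alpha> = 0] (mod int d) \<Longrightarrow> \<not> [\<beta> = 0] (mod int d) \<Longrightarrow> \<not> [\<alpha> * \<beta> = 0] (mod int d)"
  using prime_d by (auto simp: cong_0_iff prime_dvd_mult_iff)

text \<open>For a unit \<alpha> this is an affine bijection of the labels, with inverse x ->
  \<gamma> (x - \<beta> b). It is the change of variables behind all later reindexing in a single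
  label.\<close>

lemma sum_lc_left:
  fixes F :: "nat \<Rightarrow> 'a :: comm_monoid_add"
  assumes "\<not> [\<alpha> = 0] (mod int d)"
  shows "(\<Sum>a<D. F (lc \<alpha> a \<beta> b)) = (\<Sum>a<D. F a)"
proof -
  obtain \<gamma> where g: "[\<gamma> * \<alpha> = 1] (mod int d)" using unit_inverse[OF assms] by blast
  show ?thesis
  proof (rule sum.reindex_bij_witness[of _ "\<lambda>x. lc \<gamma> x (- \<gamma> * \<beta>) b" "\<lambda>a. lc \<alpha> a \<beta> b"])
    fix a assume "a \<in> {..<D}"
    then have a: "lc 1 a 0 b = a" by (simp add: lc_1_0)
    have "lc (\<gamma> * \<alpha>) a (\<gamma> * \<beta> + - \<gamma> * \<beta>) b = lc 1 a 0 b"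
      by (rule lc_cong[OF g]) (simp add: cong_refl)
    then show "lc \<gamma> (lc \<alpha> a \<beta> b) (- \<gamma> * \<beta>) b = a" unfolding lc_lc_left a .
    have "[\<alpha> * (- \<gamma> * \<beta>) + \<beta> = 0] (mod int d)"
      using cong_add[OF cong_scalar_right[OF g, of "- \<beta>"] cong_refl[of \<beta>]] by (simp add: mult_ac)
    moreover have "[\<alpha> * \<gamma> = 1] (mod int d)" using g by (simp add: mult.commute)
    ultimately have "lc (\<alpha> * \<gamma>) a (\<alpha> * (- \<gamma> * \<beta>) + \<beta>) b = lc 1 a 0 b"
      by (intro lc_cong)
    then show "lc \<alpha> (lc \<gamma> a (- \<gamma> * \<beta>) b) \<beta> b = a" unfolding lc_lc_left a .
  qed auto
qed

lemma sum_lc_right: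
  fixes F :: "nat \<Rightarrow> 'a :: comm_monoid_add"
  assumes "\<not> [\<beta> = 0] (mod int d)"
  shows "(\<Sum>b<D. F (lc \<alpha> a \<beta> b)) = (\<Sum>b<D. F b)"
  unfolding lc_commute[of \<alpha>] by (rule sum_lc_left[OF assms])

lemma unit_minus_1: "\<not> [- 1 = 0] (mod int d)" and unit_1: "\<not> [1 = 0] (mod int d)"
  using prime_gt_1_nat[OF prime_d] by (auto simp: cong_0_iff)

lemma index_eqI:
  assumes "a < D" "b < D" "\<And>k. k < n \<Longrightarrow> digit d k a = digit d k b"
  shows "a = b"
proof -
  have "enc d n (\<lambda>k. int (digit d k a)) = enc d n (\<lambda>k. int (digit d k b))"
    using assms(3) by (intro enc_cong) simp
  then show ?thesis using assms(1,2) by (simp add: enc_digit)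
qed

section \<open>Fourier analysis on Z_d^n\<close>

text \<open>If \<open>r\<close> and \<open>s\<close> differ in digit \<open>k\<close>, translating
  \<open>p\<close> by the unit vector \<open>u\<close> at \<open>k\<close> leaves the sum unchanged
  and also multiplies it by a number other than 1.\<close>

lemma chi_orthogonal:
  assumes "r < D" "s < D"
  shows "(\<Sum>p<D. chi d (dot p r - dot p s)) = (if r = s then of_nat D else 0)"
proof (cases "r = s")
  case False
  then obtain k where k: "k < n" "digit d k r \<noteq> digit d k s" using index_eqI[OF assms] by blast
  define u where "u = enc d n (\<lambda>j. if j = k then 1 else 0)"
  have u: "dot u x = int (digit d k x)" for x
  proof -
    have "dot u x = (\<Sum>j<n. if j = k then int (digit d k x) else 0)"
      unfolding dot_def u_def using prime_gt_1_nat[OF prime_d]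
      by (intro sum.cong) (auto simp: digit_enc)
    then show ?thesis using k by simp
  qed
  have ne: "chi d (dot u r - dot u s) \<noteq> 1"
  proof
    assume "chi d (dot u r - dot u s) = 1"
    then have "[int (digit d k r) = int (digit d k s)] (mod int d)"
      by (simp add: u chi_eq_1_iff cong_iff_dvd_diff)
    then show False using k by (simp add: cong_def digit_less flip: zmod_int)
  qed
  let ?S = "\<Sum>p<D. chi d (dot p r - dot p s)"
  have "?S = (\<Sum>p<D. chi d (dot (lc 1 p 1 u) r - dot (lc 1 p 1 u) s))"
    by (rule sum_lc_left[OF unit_1, symmetric])
  also have "\<dots> = (\<Sum>p<D. chi d ((dot p r - dot p s) + (dot u r - dot u s)))"
  proof (intro sum.cong refl chi_cong)
    fix p
    show "[dot (lc 1 p 1 u) r - dot (lc 1 p 1 u) s = dot p r - dot p s + (dot u r - dot u s)] (mod int d)"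
      using cong_diff[OF dot_lc_left[of 1 p 1 u r] dot_lc_left[of 1 p 1 u s]]
      by (simp add: algebra_simps)
  qed simp
  also have "\<dots> = chi d (dot u r - dot u s) * ?S"
    by (simp add: chi_add sum_distrib_left mult.commute)
  finally have "?S = 0" using ne by simp
  then show ?thesis using False by simp
qed simp

lemma parseval:
  "(\<Sum>p<D. (cmod (\<Sum>r<D. chi d (dot p r) * h r))\<^sup>2) = real D * (\<Sum>r<D. (cmod (h r))\<^sup>2)"
proof -
  have "of_real (\<Sum>p<D. (cmod (\<Sum>r<D. chi d (dot p r) * h r))\<^sup>2)
      = (\<Sum>p<D. \<Sum>r<D. \<Sum>s<D. chi d (dot p r - dot p s) * (h r * cnj (h s)))"
    unfolding of_real_sum complex_norm_square cnj_sum sum_product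
    by (intro sum.cong refl) (simp add: cnj_chi chi_diff mult_ac)
  also have "\<dots> = (\<Sum>r<D. \<Sum>p<D. \<Sum>s<D. chi d (dot p r - dot p s) * (h r * cnj (h s)))"
    by (rule sum.swap)
  also have "\<dots> = (\<Sum>r<D. \<Sum>s<D. (\<Sum>p<D. chi d (dot p r - dot p s)) * (h r * cnj (h s)))"
    unfolding sum_distrib_right by (intro sum.cong refl sum.swap)
  also have "\<dots> = (\<Sum>r<D. \<Sum>s<D. if r = s then of_nat D * (h r * cnj (h r)) else 0)"
    by (intro sum.cong refl) (auto simp: chi_orthogonal)
  also have "\<dots> = of_real (real D * (\<Sum>r<D. (cmod (h r))\<^sup>2))"
    unfolding of_real_mult of_real_sum complex_norm_square by (simp add: sum_distrib_left)
  finally show ?thesis unfolding of_real_eq_iff .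
qed

text \<open>The Weyl phase is left out: only moduli of \<open>cf\<close> are evaluated, and
  \<open>cf_conv\<close> then holds without phase factors.\<close>

definition cf :: "complex mat \<Rightarrow> nat \<Rightarrow> nat \<Rightarrow> complex" where
  "cf A p q = (\<Sum>r<D. chi d (dot p r) * A $$ (lc 1 r (- 1) q, r))"

text \<open>Parseval is applied in \<open>p\<close> for each fixed \<open>q\<close>; as
  \<open>q\<close> varies, the row index r - q runs through all labels.\<close>

lemma sum_cf_square: "(\<Sum>p<D. \<Sum>q<D. (cmod (cf A p q))\<^sup>2) = real D * purity D A"
proof -
  have "(\<Sum>p<D. \<Sum>q<D. (cmod (cf A p q))\<^sup>2)
      = (\<Sum>q<D. real D * (\<Sum>r<D. (cmod (A $$ (lc 1 r (- 1) q, r)))\<^sup>2))"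
    unfolding cf_def by (subst sum.swap) (simp only: parseval)
  also have "\<dots> = real D * (\<Sum>r<D. \<Sum>q<D. (cmod (A $$ (lc 1 r (- 1) q, r)))\<^sup>2)"
    unfolding sum_distrib_left by (rule sum.swap)
  also have "\<dots> = real D * (\<Sum>r<D. \<Sum>i<D. (cmod (A $$ (i, r)))\<^sup>2)"
    by (simp only: sum_lc_right[OF unit_minus_1, of "\<lambda>i. (cmod (A $$ (i, _)))\<^sup>2"])
  finally show ?thesis unfolding purity_def by (subst sum.swap)
qed

end

text \<open>Positivity is tested on e_i + u e_j, with the phase \<open>u\<close> chosen so that the
  off-diagonal terms contribute -2 |A_ij|. The arithmetic mean, rather than the sharper geometric
  one, is what adds up to a trace later.\<close>

lemma density_op_entry_le:
  assumes A: "density_op m A" and ij: "i < m" "j < m"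
  shows "cmod (A $$ (i,j)) \<le> (Re (A $$ (i,i)) + Re (A $$ (j,j))) / 2"
proof -
  have c: "A \<in> carrier_mat m m" and h: "adj A = A"
    and pos: "\<And>v. v \<in> carrier_vec m \<Longrightarrow> 0 \<le> Re (conjugate v \<bullet> (A *\<^sub>v v))"
    using A by (auto simp: density_op_def)
  obtain u where u: "cmod u = 1" "u * A $$ (i,j) = - of_real (cmod (A $$ (i,j)))"
  proof (cases "A $$ (i,j) = 0")
    case False
    show ?thesis
      by (rule that[of "- of_real (cmod (A $$ (i,j))) / A $$ (i,j)"])
        (use False in \<open>simp_all add: norm_divide\<close>)
  qed (use that[of 1] in simp)
  define e where "e t k = (if k = t then 1 else 0 :: complex)" for t k :: nat
  define v where "v = vec m (\<lambda>k. e i k + u * e j k)"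
  have E: "(\<Sum>k<m. e t k * f k) = f t" if "t < m" for t f
    unfolding e_def using that by (simp add: if_distrib[of "\<lambda>x. x * _"] cong: if_cong)
  have "conjugate v \<bullet> (A *\<^sub>v v)
      = (\<Sum>k<m. \<Sum>l<m. cnj (v $ k) * A $$ (k,l) * v $ l)"
    by (rule cscalar_mult_mat_vec[OF c]) (simp add: v_def)
  also have "\<dots> = (\<Sum>k<m. (e i k + cnj u * e j k) * (\<Sum>l<m. e i l * A $$ (k,l) + u * (e j l * A $$ (k,l))))"
    unfolding sum_distrib_left
    by (intro sum.cong refl) (auto simp: v_def e_def algebra_simps)
  also have "\<dots> = (\<Sum>k<m. (e i k + cnj u * e j k) * (A $$ (k,i) + u * A $$ (k,j)))"
    using ij by (simp add: sum.distrib E flip: sum_distrib_left)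
  also have "\<dots> = (\<Sum>k<m. e i k * (A $$ (k,i) + u * A $$ (k,j)))
      + cnj u * (\<Sum>k<m. e j k * (A $$ (k,i) + u * A $$ (k,j)))"
    by (simp add: ring_distribs sum.distrib sum_distrib_left mult.assoc)
  also have "\<dots> = A $$ (i,i) + u * A $$ (i,j) + cnj (u * A $$ (i,j)) + (u * cnj u) * A $$ (j,j)"
    unfolding E[OF ij(1)] E[OF ij(2)] by (simp add: hermitian_entry[OF h c ij] algebra_simps)
  also have "u * cnj u = 1" using u(1) by (simp add: complex_norm_square[symmetric])
  finally have "Re (conjugate v \<bullet> (A *\<^sub>v v)) = Re (A $$ (i,i)) + Re (A $$ (j,j)) - 2 * cmod (A $$ (i,j))"
    by (simp add: u(2))
  moreover have "0 \<le> Re (conjugate v \<bullet> (A *\<^sub>v v))" by (rule pos) (simp add: v_def)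
  ultimately show ?thesis by simp
qed

context qudits
begin

text \<open>Each entry is bounded by the mean of two diagonal entries. Both families of diagonal
  entries sum to the trace, because r -> r - q permutes the labels.\<close>

lemma norm_cf_le_1:
  assumes "density_op D A"
  shows "cmod (cf A p q) \<le> 1"
proof -
  have "cmod (cf A p q) \<le> (\<Sum>r<D. cmod (A $$ (lc 1 r (- 1) q, r)))"
    unfolding cf_def by (rule order_trans[OF norm_sum]) (simp add: norm_mult)
  also have "\<dots> \<le> (\<Sum>r<D. (Re (A $$ (lc 1 r (- 1) q, lc 1 r (- 1) q)) + Re (A $$ (r,r))) / 2)"
    by (intro sum_mono density_op_entry_le[OF assms]) auto
  also have "\<dots> = ((\<Sum>r<D. Re (A $$ (lc 1 r (- 1) q, lc 1 r (- 1) q))) + (\<Sum>r<D. Re (A $$ (r,r)))) / 2"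
    by (simp add: sum.distrib flip: sum_divide_distrib)
  also have "(\<Sum>r<D. Re (A $$ (lc 1 r (- 1) q, lc 1 r (- 1) q))) = (\<Sum>r<D. Re (A $$ (r,r)))"
    by (rule sum_lc_left[OF unit_1, of "\<lambda>r. Re (A $$ (r,r))"])
  also have "(\<Sum>r<D. Re (A $$ (r,r))) = Re (\<Sum>r<D. A $$ (r,r))" by simp
  also have "(\<Sum>r<D. A $$ (r,r)) = 1" using assms by (simp add: density_op_def)
  finally show ?thesis by simp
qed

end

section \<open>The convolution channel\<close>

lemma density_op_outer:
  assumes v: "v \<in> carrier_vec m" and nv: "(\<Sum>i<m. (cmod (v $ i))\<^sup>2) = 1"
  shows "density_op m (outer v)"
proof -
  have dim: "dim_vec v = m" using v by simp
  have c: "outer v \<in> carrier_mat m m" by (simp add: outer_def dim)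
  have "0 \<le> Re (conjugate w \<bullet> (outer v *\<^sub>v w))" if w: "w \<in> carrier_vec m" for w
  proof -
    define z where "z = (\<Sum>j<m. cnj (v $ j) * w $ j)"
    have "conjugate w \<bullet> (outer v *\<^sub>v w) = (\<Sum>i<m. \<Sum>j<m. cnj (w $ i) * outer v $$ (i,j) * w $ j)"
      by (rule cscalar_mult_mat_vec[OF c w])
    also have "\<dots> = cnj z * z"
      unfolding z_def cnj_sum sum_product
      by (intro sum.cong refl) (simp add: outer_def dim mult_ac)
    also have "\<dots> = of_real ((cmod z)\<^sup>2)" by (simp only: complex_norm_square mult.commute)
    finally show ?thesis by simp
  qed
  moreover have "adj (outer v) = outer v"
    by (intro eq_matI) (auto simp: adj_def outer_def)
  moreover have "(\<Sum>i<m. outer v $$ (i,i)) = of_real (\<Sum>i<m. (cmod (v $ i))\<^sup>2)"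
    unfolding of_real_sum complex_norm_square by (simp add: outer_def dim)
  ultimately show ?thesis using c nv by (simp add: density_op_def)
qed

lemma purity_outer:
  assumes v: "v \<in> carrier_vec m" and nv: "(\<Sum>i<m. (cmod (v $ i))\<^sup>2) = 1"
  shows "purity m (outer v) = 1"
proof -
  have "purity m (outer v) = (\<Sum>i<m. (cmod (v $ i))\<^sup>2) * (\<Sum>i<m. (cmod (v $ i))\<^sup>2)"
    unfolding purity_def sum_product using v
    by (intro sum.cong refl) (simp add: outer_def norm_mult power_mult_distrib)
  then show ?thesis by (simp add: nv)
qed

lemma density_op_mixture:
  assumes p: "\<And>i. i < k \<Longrightarrow> 0 \<le> p i \<and> density_op m (M i)" and p1: "(\<Sum>i<k. p i) = 1"
  shows "density_op m (mat m m (\<lambda>(r,c). \<Sum>i<k. complex_of_real (p i) * M i $$ (r,c)))"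
    (is "density_op m ?A")
proof -
  have c: "M i \<in> carrier_mat m m" and h: "adj (M i) = M i" and tr: "(\<Sum>r<m. M i $$ (r,r)) = 1"
    and pos: "\<And>v. v \<in> carrier_vec m \<Longrightarrow> 0 \<le> Re (conjugate v \<bullet> (M i *\<^sub>v v))" if "i < k" for i
    using p[OF that] by (auto simp: density_op_def)
  have "0 \<le> Re (conjugate v \<bullet> (?A *\<^sub>v v))" if v: "v \<in> carrier_vec m" for v
  proof -
    have "conjugate v \<bullet> (?A *\<^sub>v v)
        = (\<Sum>r<m. \<Sum>s<m. \<Sum>i<k. complex_of_real (p i) * (cnj (v $ r) * M i $$ (r,s) * v $ s))"
      by (subst cscalar_mult_mat_vec[OF _ v])
        (auto simp: sum_distrib_left sum_distrib_right mult_ac intro!: sum.cong)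
    also have "\<dots> = (\<Sum>r<m. \<Sum>i<k. \<Sum>s<m. complex_of_real (p i) * (cnj (v $ r) * M i $$ (r,s) * v $ s))"
      by (intro sum.cong refl sum.swap)
    also have "\<dots> = (\<Sum>i<k. \<Sum>r<m. \<Sum>s<m. complex_of_real (p i) * (cnj (v $ r) * M i $$ (r,s) * v $ s))"
      by (rule sum.swap)
    also have "\<dots> = (\<Sum>i<k. complex_of_real (p i) * (conjugate v \<bullet> (M i *\<^sub>v v)))"
      by (intro sum.cong refl) (simp add: cscalar_mult_mat_vec[OF c v] sum_distrib_left)
    finally show ?thesis using p pos[OF _ v] by (auto intro!: sum_nonneg mult_nonneg_nonneg)
  qed
  moreover have "adj ?A = ?A"
  proof (rule eq_matI)
    fix i j assume "i < dim_row ?A" "j < dim_col ?A"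
    then have ij: "i < m" "j < m" by auto
    have "cnj (M l $$ (j,i)) = M l $$ (i,j)" if "l < k" for l
      using hermitian_entry[OF h[OF that] c[OF that] ij(2,1)] by simp
    then show "adj ?A $$ (i,j) = ?A $$ (i,j)" using ij by (simp add: adj_def)
  qed (simp_all add: adj_def)
  moreover have "(\<Sum>r<m. ?A $$ (r,r)) = 1"
  proof -
    have "(\<Sum>r<m. ?A $$ (r,r)) = (\<Sum>i<k. complex_of_real (p i) * (\<Sum>r<m. M i $$ (r,r)))"
      by (simp add: sum_distrib_left) (rule sum.swap)
    also have "\<dots> = complex_of_real (\<Sum>i<k. p i)" unfolding of_real_sum by (simp add: tr)
    finally show ?thesis by (simp add: p1)
  qed
  ultimately show ?thesis by (simp add: density_op_def)
qed

section \<open>The key unitary and the convolution in coordinates\<close>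

locale qudit_convolution = qudits +
  fixes g00 g01 g10 g11 :: int
  assumes g00: "\<not> [g00 = 0] (mod int d)" and g01: "\<not> [g01 = 0] (mod int d)"
    and g10: "\<not> [g10 = 0] (mod int d)" and g11: "\<not> [g11 = 0] (mod int d)"
    and det: "\<not> [g00 * g11 - g01 * g10 = 0] (mod int d)"
begin

definition N where "N = inv_mod d (g00 * g11 - g01 * g10)"

lemma N_det: "[N * (g00 * g11 - g01 * g10) = 1] (mod int d)"
proof -
  obtain \<gamma> where \<gamma>: "[\<gamma> * (g00 * g11 - g01 * g10) = 1] (mod int d)"
    using unit_inverse[OF det] by blast
  have "[\<gamma> mod int d * (g00 * g11 - g01 * g10) = 1] (mod int d)"
    using \<gamma> by (simp add: cong_def mod_mult_left_eq)
  then have "\<exists>N. 0 \<le> N \<and> N < int d \<and> [N * (g00 * g11 - g01 * g10) = 1] (mod int d)"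
    by (intro exI[of _ "\<gamma> mod int d"]) simp
  from someI_ex[OF this] show ?thesis by (simp add: N_def inv_mod_def)
qed

lemma N_unit: "\<not> [N = 0] (mod int d)"
proof
  assume "[N = 0] (mod int d)"
  from cong_scalar_right[OF this, of "g00 * g11 - g01 * g10"] N_det
  have "[1 = 0] (mod int d)" by (metis cong_sym cong_trans mult_zero_left)
  with unit_1 show False by simp
qed

text \<open>The key unitary permutes basis labels by the inverse transpose of G, which is
  \<open>fwd1\<close>, \<open>fwd2\<close>. The inverse map \<open>bwd1\<close>, \<open>bwd2\<close>
  is the transpose of G itself, so entries of the output are free of \<open>N\<close>.\<close>

abbreviation fwd1 where "fwd1 i j \<equiv> lc (N * g11) i (- (N * g10)) j"
abbreviation fwd2 where "fwd2 i j \<equiv> lc (- (N * g01)) i (N * g00) j"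
abbreviation bwd1 where "bwd1 a b \<equiv> lc g00 a g10 b"
abbreviation bwd2 where "bwd2 a b \<equiv> lc g01 a g11 b"

lemma bwd_fwd:
  assumes "i < D" "j < D"
  shows "bwd1 (fwd1 i j) (fwd2 i j) = i" "bwd2 (fwd1 i j) (fwd2 i j) = j"
proof -
  have 1: "[g00 * (N * g11) + g10 * (- (N * g01)) = 1] (mod int d)"
    "[g01 * (- (N * g10)) + g11 * (N * g00) = 1] (mod int d)"
    using N_det by (simp_all add: algebra_simps)
  have 0: "[g00 * (- (N * g10)) + g10 * (N * g00) = 0] (mod int d)"
    "[g01 * (N * g11) + g11 * (- (N * g01)) = 0] (mod int d)"
    by (simp_all add: algebra_simps)
  show "bwd1 (fwd1 i j) (fwd2 i j) = i"
    unfolding lc_lc using lc_cong[OF 1(1) 0(1), of i j] assms by (simp add: lc_1_0)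
  show "bwd2 (fwd1 i j) (fwd2 i j) = j"
    unfolding lc_lc using lc_cong[OF 0(2) 1(2), of i j] assms by (simp add: lc_0_1)
qed

lemma fwd_bwd:
  assumes "a < D" "b < D"
  shows "fwd1 (bwd1 a b) (bwd2 a b) = a" "fwd2 (bwd1 a b) (bwd2 a b) = b"
proof -
  have 1: "[N * g11 * g00 + - (N * g10) * g01 = 1] (mod int d)"
    "[- (N * g01) * g10 + N * g00 * g11 = 1] (mod int d)"
    using N_det by (simp_all add: algebra_simps)
  have 0: "[N * g11 * g10 + - (N * g10) * g11 = 0] (mod int d)"
    "[- (N * g01) * g00 + N * g00 * g01 = 0] (mod int d)"
    by (simp_all add: algebra_simps)
  show "fwd1 (bwd1 a b) (bwd2 a b) = a"
    unfolding lc_lc using lc_cong[OF 1(1) 0(1), of a b] assms by (simp add: lc_1_0)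
  show "fwd2 (bwd1 a b) (bwd2 a b) = b"
    unfolding lc_lc using lc_cong[OF 0(2) 1(2), of a b] assms by (simp add: lc_0_1)
qed

lemma sum_bwd:
  fixes F :: "nat \<Rightarrow> nat \<Rightarrow> 'a :: comm_monoid_add"
  shows "(\<Sum>a<D. \<Sum>b<D. F (bwd1 a b) (bwd2 a b)) = (\<Sum>i<D. \<Sum>j<D. F i j)"
  unfolding sum.cartesian_product
  by (rule sum.reindex_bij_witness[of _ "\<lambda>(i,j). (fwd1 i j, fwd2 i j)" "\<lambda>(a,b). (bwd1 a b, bwd2 a b)"])
    (auto simp: bwd_fwd fwd_bwd)

lemma key_perm_eq:
  "key_perm d n g00 g01 g10 g11 x = fwd1 (x div D) (x mod D) * D + fwd2 (x div D) (x mod D)"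
  unfolding key_perm_def Let_def N_def[symmetric] lc_def by simp

text \<open>\<open>key_unitary\<close> prescribes the row belonging to each column; evaluating
  matrix products needs the column belonging to each row.\<close>

lemma eq_key_perm_iff:
  assumes "x < D * D" "y < D * D"
  shows "y = key_perm d n g00 g01 g10 g11 x
    \<longleftrightarrow> x = bwd1 (y div D) (y mod D) * D + bwd2 (y div D) (y mod D)"
proof -
  have x: "x div D < D" "x mod D < D" and y: "y div D < D" "y mod D < D"
    using assms by (auto simp: less_mult_imp_div_less)
  show ?thesis
  proof
    assume "y = key_perm d n g00 g01 g10 g11 x"
    then have "y div D = fwd1 (x div D) (x mod D)" "y mod D = fwd2 (x div D) (x mod D)"
      by (simp_all add: key_perm_eq)
    then show "x = bwd1 (y div D) (y mod D) * D + bwd2 (y div D) (y mod D)"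
      using x by (simp only: bwd_fwd div_mult_mod_eq)
  next
    assume "x = bwd1 (y div D) (y mod D) * D + bwd2 (y div D) (y mod D)"
    then have "x div D = bwd1 (y div D) (y mod D)" "x mod D = bwd2 (y div D) (y mod D)"
      by simp_all
    then show "y = key_perm d n g00 g01 g10 g11 x"
      using y by (simp only: key_perm_eq fwd_bwd div_mult_mod_eq)
  qed
qed

abbreviation conv where "conv \<equiv> boxtimes d n g00 g01 g10 g11"

lemma conv_carrier: "conv \<rho> \<sigma> \<in> carrier_mat D D"
  by (simp add: boxtimes_def ptrace2_def Let_def)

text \<open>U is a permutation matrix, so conjugation only relabels rows and columns by the inverse
  permutation \<open>w\<close>: every sum in the two products has a single nonzero term.\<close>

lemma conv_entry:
  assumes "a < D" "a' < D"
  shows "conv \<rho> \<sigma> $$ (a,a')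
    = (\<Sum>b<D. \<rho> $$ (bwd1 a b, bwd1 a' b) * \<sigma> $$ (bwd2 a b, bwd2 a' b))"
proof -
  define U where "U = key_unitary d n g00 g01 g10 g11"
  define M where "M = tensor D \<rho> \<sigma>"
  define w where "w y = bwd1 (y div D) (y mod D) * D + bwd2 (y div D) (y mod D)" for y
  have U: "U \<in> carrier_mat (D * D) (D * D)" and M: "M \<in> carrier_mat (D * D) (D * D)"
    and aU: "adj U \<in> carrier_mat (D * D) (D * D)"
    by (simp_all add: U_def key_unitary_def M_def tensor_def adj_def)
  have pair_less: "x * D + y < D * D" if "x < D" "y < D" for x y
  proof -
    have "x * D + y < Suc x * D" using that by simp
    also have "\<dots> \<le> D * D" using that by (intro mult_right_mono) auto
    finally show ?thesis .
  qed
  have w: "w y < D * D" for y unfolding w_def by (intro pair_less lc_less)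
  have Ue: "U $$ (x,s) = (if s = w x then 1 else 0)" if "x < D * D" "s < D * D" for x s
    using that by (simp add: U_def key_unitary_def eq_key_perm_iff w_def)
  have UM: "(U * M) $$ (x,t) = M $$ (w x, t)" if "x < D * D" "t < D * D" for x t
  proof -
    have "(U * M) $$ (x,t) = (\<Sum>s<D * D. U $$ (x,s) * M $$ (s,t))"
      by (rule mult_mat_entry[OF U M that])
    also have "\<dots> = (\<Sum>s<D * D. if s = w x then M $$ (w x,t) else 0)"
      using that by (intro sum.cong) (auto simp: Ue)
    finally show ?thesis using w by simp
  qed
  have UMU: "(U * M * adj U) $$ (x,y) = M $$ (w x, w y)" if "x < D * D" "y < D * D" for x y
  proof -
    have "(U * M * adj U) $$ (x,y) = (\<Sum>t<D * D. (U * M) $$ (x,t) * adj U $$ (t,y))"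
      by (rule mult_mat_entry[OF mult_carrier_mat[OF U M] aU that])
    also have "\<dots> = (\<Sum>t<D * D. if t = w y then M $$ (w x,w y) else 0)"
      using that U by (intro sum.cong) (auto simp: UM adj_def Ue)
    finally show ?thesis using w by simp
  qed
  have "conv \<rho> \<sigma> $$ (a,a') = (\<Sum>b<D. (U * M * adj U) $$ (a * D + b, a' * D + b))"
    using assms by (simp add: boxtimes_def ptrace2_def Let_def U_def M_def)
  also have "\<dots> = (\<Sum>b<D. M $$ (w (a * D + b), w (a' * D + b)))"
    using assms by (intro sum.cong refl UMU pair_less) auto
  also have "\<dots> = (\<Sum>b<D. \<rho> $$ (bwd1 a b, bwd1 a' b) * \<sigma> $$ (bwd2 a b, bwd2 a' b))"
    by (intro sum.cong refl) (simp add: M_def tensor_def w_def pair_less)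
  finally show ?thesis .
qed

text \<open>Sum over i = \<open>bwd1 a b\<close>, j = \<open>bwd2 a b\<close> instead of a, b.
  Translating a by q translates i by g00 q and j by g01 q, while the character at a =
  \<open>fwd1 i j\<close> splits into one in i and one in j. The double sum then factorises.\<close>

lemma cf_conv:
  assumes "p < D" "q < D"
  shows "cf (conv \<rho> \<sigma>) p q
    = cf \<rho> (smul (N * g11) p) (smul g00 q) * cf \<sigma> (smul (- (N * g10)) p) (smul g01 q)"
proof -
  have shift: "lc \<alpha> (lc 1 a (- 1) q) \<beta> b = lc 1 (lc \<alpha> a \<beta> b) (- 1) (smul \<alpha> q)" for \<alpha> \<beta> a b
    unfolding lc_def[of \<alpha> "lc 1 a (- 1) q"] lc_def[of 1 "lc \<alpha> a \<beta> b"]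
  proof (rule enc_cong)
    fix k assume "k < n"
    note c = cong_digit_lc[OF this]
    have "[\<alpha> * int (digit d k (lc 1 a (- 1) q)) + \<beta> * int (digit d k b)
        = \<alpha> * (1 * int (digit d k a) + (- 1) * int (digit d k q)) + \<beta> * int (digit d k b)] (mod int d)"
      by (intro cong_add cong_scalar_left c cong_refl)
    moreover have "[1 * int (digit d k (lc \<alpha> a \<beta> b)) + (- 1) * int (digit d k (smul \<alpha> q))
        = 1 * (\<alpha> * int (digit d k a) + \<beta> * int (digit d k b))
          + (- 1) * (\<alpha> * int (digit d k q) + 0 * int (digit d k 0))] (mod int d)"
      by (intro cong_add cong_scalar_left c)
    ultimately show "(\<alpha> * int (digit d k (lc 1 a (- 1) q)) + \<beta> * int (digit d k b)) mod int d
      = (1 * int (digit d k (lc \<alpha> a \<beta> b)) + (- 1) * int (digit d k (smul \<alpha> q))) mod int d"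
      by (simp add: cong_def algebra_simps)
  qed
  have dots: "chi d (dot p (fwd1 i j)) = chi d (dot (smul (N * g11) p) i) * chi d (dot (smul (- (N * g10)) p) j)" for i j
  proof -
    have "[dot (smul (N * g11) p) i + dot (smul (- (N * g10)) p) j
        = (N * g11 * dot p i + 0 * dot 0 i) + (- (N * g10) * dot p j + 0 * dot 0 j)] (mod int d)"
      by (intro cong_add dot_lc_left)
    then have "chi d (dot (smul (N * g11) p) i + dot (smul (- (N * g10)) p) j)
        = chi d (N * g11 * dot p i + - (N * g10) * dot p j)"
      by (intro chi_cong) simp_all
    then show ?thesis by (simp add: chi_dot_lc chi_add)
  qed
  define F where "F i j = chi d (dot p (fwd1 i j)) *
    (\<rho> $$ (lc 1 i (- 1) (smul g00 q), i) * \<sigma> $$ (lc 1 j (- 1) (smul g01 q), j))" for i j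
  have "cf (conv \<rho> \<sigma>) p q = (\<Sum>a<D. \<Sum>b<D. F (bwd1 a b) (bwd2 a b))"
    unfolding cf_def F_def
    by (intro sum.cong refl) (simp add: conv_entry shift fwd_bwd sum_distrib_left)
  also have "\<dots> = (\<Sum>i<D. \<Sum>j<D. F i j)" by (rule sum_bwd)
  also have "\<dots> = cf \<rho> (smul (N * g11) p) (smul g00 q) * cf \<sigma> (smul (- (N * g10)) p) (smul g01 q)"
    unfolding cf_def sum_product F_def dots by (intro sum.cong refl) (simp add: mult_ac)
  finally show ?thesis .
qed

lemma density_op_conv:
  assumes \<rho>: "density_op D \<rho>" and v: "v \<in> carrier_vec D" and nv: "(\<Sum>i<D. (cmod (v $ i))\<^sup>2) = 1"
  shows "density_op D (conv \<rho> (outer v))"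
proof -
  have c: "\<rho> \<in> carrier_mat D D" and h: "adj \<rho> = \<rho>" and tr: "(\<Sum>i<D. \<rho> $$ (i,i)) = 1"
    and pos: "\<And>v. v \<in> carrier_vec D \<Longrightarrow> 0 \<le> Re (conjugate v \<bullet> (\<rho> *\<^sub>v v))"
    using \<rho> by (auto simp: density_op_def)
  have dim: "dim_vec v = D" using v by simp
  have tv: "(\<Sum>i<D. outer v $$ (i,i)) = 1"
    using density_op_outer[OF v nv] by (simp add: density_op_def)
  obtain \<gamma> where \<gamma>: "[\<gamma> * g00 = 1] (mod int d)" using unit_inverse[OF g00] by blast
  have inv: "lc \<gamma> (bwd1 a b) (- (\<gamma> * g10)) b = a" if "a < D" for a b
    using lc_cong[OF \<gamma>, of "\<gamma> * g10 + - (\<gamma> * g10)" 0 a b] that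
    unfolding lc_lc_left by (simp add: lc_1_0)
  have "0 \<le> Re (conjugate w \<bullet> (conv \<rho> (outer v) *\<^sub>v w))" if w: "w \<in> carrier_vec D" for w
  proof -
    \<comment> \<open>The channel is a sum over \<open>b\<close> of Kraus terms, the b-th operator
      having the entry \<open>v $ bwd2 a b\<close> at row \<open>a\<close> and column
      \<open>bwd1 a b\<close>. \<open>u b\<close> is its adjoint applied to \<open>w\<close>;
      \<open>a\<close> is recovered from the column index through \<open>\<gamma>\<close>.\<close>
    define u where "u b = vec D (\<lambda>i. let a = lc \<gamma> i (- (\<gamma> * g10)) b in cnj (v $ bwd2 a b) * w $ a)" for b
    have ub: "u b $ bwd1 a b = cnj (v $ bwd2 a b) * w $ a" if "a < D" for a b
      using that by (simp add: u_def inv Let_def)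
    have "conjugate w \<bullet> (conv \<rho> (outer v) *\<^sub>v w)
        = (\<Sum>a<D. \<Sum>a'<D. \<Sum>b<D. cnj (u b $ bwd1 a b) * \<rho> $$ (bwd1 a b, bwd1 a' b) * u b $ bwd1 a' b)"
      unfolding cscalar_mult_mat_vec[OF conv_carrier w]
      by (intro sum.cong refl)
        (simp add: conv_entry ub sum_distrib_left sum_distrib_right outer_def dim mult_ac)
    also have "\<dots> = (\<Sum>a<D. \<Sum>b<D. \<Sum>a'<D. cnj (u b $ bwd1 a b) * \<rho> $$ (bwd1 a b, bwd1 a' b) * u b $ bwd1 a' b)"
      by (intro sum.cong refl sum.swap)
    also have "\<dots> = (\<Sum>b<D. \<Sum>a<D. \<Sum>a'<D. cnj (u b $ bwd1 a b) * \<rho> $$ (bwd1 a b, bwd1 a' b) * u b $ bwd1 a' b)"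
      by (rule sum.swap)
    also have "\<dots> = (\<Sum>b<D. \<Sum>i<D. \<Sum>i'<D. cnj (u b $ i) * \<rho> $$ (i, i') * u b $ i')"
    proof (rule sum.cong[OF refl])
      fix b
      have "(\<Sum>a<D. \<Sum>a'<D. cnj (u b $ bwd1 a b) * \<rho> $$ (bwd1 a b, bwd1 a' b) * u b $ bwd1 a' b)
          = (\<Sum>a<D. \<Sum>i'<D. cnj (u b $ bwd1 a b) * \<rho> $$ (bwd1 a b, i') * u b $ i')"
        by (rule sum.cong[OF refl])
          (rule sum_lc_left[OF g00, of "\<lambda>i'. cnj (u b $ bwd1 _ b) * \<rho> $$ (bwd1 _ b, i') * u b $ i'"])
      also have "\<dots> = (\<Sum>i<D. \<Sum>i'<D. cnj (u b $ i) * \<rho> $$ (i, i') * u b $ i')"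
        by (rule sum_lc_left[OF g00, of "\<lambda>i. \<Sum>i'<D. cnj (u b $ i) * \<rho> $$ (i, i') * u b $ i'"])
      finally show "(\<Sum>a<D. \<Sum>a'<D. cnj (u b $ bwd1 a b) * \<rho> $$ (bwd1 a b, bwd1 a' b) * u b $ bwd1 a' b)
          = (\<Sum>i<D. \<Sum>i'<D. cnj (u b $ i) * \<rho> $$ (i, i') * u b $ i')" .
    qed
    also have "\<dots> = (\<Sum>b<D. conjugate (u b) \<bullet> (\<rho> *\<^sub>v u b))"
      by (intro sum.cong refl cscalar_mult_mat_vec[OF c, symmetric]) (simp add: u_def)
    finally show ?thesis using pos by (simp add: u_def sum_nonneg)
  qed
  moreover have "adj (conv \<rho> (outer v)) = conv \<rho> (outer v)"
  proof (rule eq_matI)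
    fix i j assume "i < dim_row (conv \<rho> (outer v))" "j < dim_col (conv \<rho> (outer v))"
    then have ij: "i < D" "j < D" using conv_carrier[of \<rho> "outer v"] by auto
    have "adj (conv \<rho> (outer v)) $$ (i,j) = cnj (conv \<rho> (outer v) $$ (j,i))"
      using ij conv_carrier[of \<rho> "outer v"] by (auto simp: adj_def)
    also have "\<dots> = conv \<rho> (outer v) $$ (i,j)"
      unfolding conv_entry[OF ij] conv_entry[OF ij(2,1)] cnj_sum
    proof (intro sum.cong refl)
      fix b
      show "cnj (\<rho> $$ (bwd1 j b, bwd1 i b) * outer v $$ (bwd2 j b, bwd2 i b))
          = \<rho> $$ (bwd1 i b, bwd1 j b) * outer v $$ (bwd2 i b, bwd2 j b)"
        using hermitian_entry[OF h c, of "bwd1 j b" "bwd1 i b"] by (simp add: outer_def dim)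
    qed
    finally show "adj (conv \<rho> (outer v)) $$ (i,j) = conv \<rho> (outer v) $$ (i,j)" .
  qed (use conv_carrier[of \<rho> "outer v"] in \<open>auto simp: adj_def\<close>)
  moreover have "(\<Sum>a<D. conv \<rho> (outer v) $$ (a,a)) = 1"
  proof -
    have "(\<Sum>a<D. conv \<rho> (outer v) $$ (a,a))
        = (\<Sum>a<D. \<Sum>b<D. \<rho> $$ (bwd1 a b, bwd1 a b) * outer v $$ (bwd2 a b, bwd2 a b))"
      by (intro sum.cong refl conv_entry) auto
    also have "\<dots> = (\<Sum>i<D. \<Sum>j<D. \<rho> $$ (i,i) * outer v $$ (j,j))"
      by (rule sum_bwd[of "\<lambda>i j. \<rho> $$ (i,i) * outer v $$ (j,j)"])
    also have "\<dots> = (\<Sum>i<D. \<rho> $$ (i,i)) * (\<Sum>j<D. outer v $$ (j,j))" by (rule sum_product[symmetric])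
    finally show ?thesis by (simp add: tr tv)
  qed
  ultimately show ?thesis using conv_carrier by (simp add: density_op_def)
qed

end

section \<open>Weyl operators\<close>

lemma chi_sum: "chi d (\<Sum>k\<in>K. f k) = (\<Prod>k\<in>K. chi d (f k))"
  by (induction K rule: infinite_finite_induct) (simp_all add: chi_add)

lemma sum_chi_mult:
  assumes "d > 0" "k < d"
  shows "(\<Sum>j<d. chi d (- (int k * int j))) = (if k = 0 then of_nat d else 0)"
proof (cases "k = 0")
  case False
  define z where "z = chi d (- int k)"
  have "\<not> d dvd k" using False assms(2) by (auto dest: dvd_imp_le)
  then have "\<not> int d dvd - int k" by simp
  then have "z \<noteq> 1" unfolding z_def chi_eq_1_iff[OF assms(1)] .
  have "z ^ d = chi d (int d * (- int k))" unfolding z_def chi_of_nat_mult ..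
  also have "\<dots> = 1" by (subst chi_eq_1_iff[OF assms(1)]) simp
  finally have "z ^ d = 1" .
  have "(\<Sum>j<d. chi d (- (int k * int j))) = (\<Sum>j<d. z ^ j)"
    unfolding z_def by (intro sum.cong refl) (simp add: mult.commute flip: chi_of_nat_mult)
  also have "\<dots> = 0" using \<open>z \<noteq> 1\<close> \<open>z ^ d = 1\<close> by (simp add: sum_gp_strict)
  finally show ?thesis using False by simp
qed simp

context qudits
begin

lemma lc_sub_add: "lc 1 r (- 1) (lc 1 q 1 q') = lc 1 (lc 1 r (- 1) q) (- 1) q'"
  unfolding lc_def[of 1 r "- 1" "lc 1 q 1 q'"] lc_def[of 1 "lc 1 r (- 1) q"]
proof (rule enc_cong)
  fix k assume "k < n"
  note c = cong_digit_lc[OF this]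
  have "[1 * int (digit d k r) + (- 1) * int (digit d k (lc 1 q 1 q'))
      = 1 * int (digit d k r) + (- 1) * (1 * int (digit d k q) + 1 * int (digit d k q'))] (mod int d)"
    by (intro cong_add cong_scalar_left c cong_refl)
  moreover have "[1 * int (digit d k (lc 1 r (- 1) q)) + (- 1) * int (digit d k q')
      = 1 * (1 * int (digit d k r) + (- 1) * int (digit d k q)) + (- 1) * int (digit d k q')] (mod int d)"
    by (intro cong_add cong_scalar_left c cong_refl)
  ultimately show "(1 * int (digit d k r) + (- 1) * int (digit d k (lc 1 q 1 q'))) mod int d
      = (1 * int (digit d k (lc 1 r (- 1) q)) + (- 1) * int (digit d k q')) mod int d"
    by (simp add: cong_def algebra_simps)
qed

lemma lc_sub_sub_commute: "lc 1 (lc 1 r (- 1) q) (- 1) q' = lc 1 (lc 1 r (- 1) q') (- 1) q"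
  using lc_sub_add[of r q q'] lc_sub_add[of r q' q] by (simp add: lc_commute[of 1 q 1 q'])

text \<open>\<open>Z\<^sup>p X\<^sup>q\<close>, i.e. the Weyl operator \<open>w(p, q)\<close> without its phase, acting on wave functions.\<close>

definition T :: "nat \<Rightarrow> nat \<Rightarrow> (nat \<Rightarrow> complex) \<Rightarrow> nat \<Rightarrow> complex" where
  "T p q v r = chi d (dot p r) * v (lc 1 r (- 1) q)"

lemma T_cong: "(\<And>i. i < D \<Longrightarrow> v i = w i) \<Longrightarrow> T p q v r = T p q w r"
  by (simp add: T_def)

lemma T_scale: "T p q (\<lambda>i. c * v i) r = c * T p q v r"
  by (simp add: T_def)

lemma T_sum: "T p q (\<lambda>i. \<Sum>k\<in>K. f k i) r = (\<Sum>k\<in>K. T p q (f k) r)"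
  by (simp add: T_def sum_distrib_left)

lemma T_T: "T p q (T p' q' v) r
    = chi d (dot p r + dot p' r - dot p' q) * v (lc 1 (lc 1 r (- 1) q) (- 1) q')"
  by (simp add: T_def chi_dot_lc chi_add chi_diff)

text \<open>The exponent is the symplectic form of the two labels; its vanishing mod
  \<open>d\<close> is the commutation condition used from here on.\<close>

lemma T_commute: "T p q (T p' q' v) r = chi d (dot p q' - dot p' q) * T p' q' (T p q v) r"
proof -
  have "dot p r + dot p' r - dot p' q = (dot p q' - dot p' q) + (dot p' r + dot p r - dot p q')"
    by simp
  then show ?thesis unfolding T_T lc_sub_sub_commute[of r q q'] by (simp only: chi_add mult.assoc)
qed

lemma T_add: "T (vadd d n p p') (vadd d n q q') v r = chi d (dot p' q) * T p q (T p' q' v) r"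
proof -
  have "chi d (dot (lc 1 p 1 p') r) = chi d (1 * dot p r + 1 * dot p' r)"
    by (intro chi_cong dot_lc_left) simp
  also have "\<dots> = chi d (dot p' q) * chi d (dot p r + dot p' r - dot p' q)"
    by (simp flip: chi_add)
  finally show ?thesis unfolding T_T vadd_lc by (simp add: T_def lc_sub_add)
qed

text \<open>The i-th factor meets an argument already translated by i q, which contributes - i p.q
  to the exponent; hence the triangular number.\<close>

lemma T_power:
  "(T p q ^^ k) v r = chi d (int k * dot p r - (\<Sum>i<k. int i) * dot p q) * v (lc 1 r (- int k) q)"
  if "r < D"
  using that
proof (induction k arbitrary: r)
  case 0
  then show ?case by (simp add: lc_1_0)
next
  case (Suc k)
  have "[int k * dot p (lc 1 r (- 1) q) = int k * (1 * dot p r + (- 1) * dot p q)] (mod int d)"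
    by (intro cong_scalar_left dot_lc)
  then have c: "chi d (int k * dot p (lc 1 r (- 1) q)) = chi d (int k * (1 * dot p r + (- 1) * dot p q))"
    by (intro chi_cong) auto
  have "(T p q ^^ Suc k) v r = chi d (dot p r) *
      (chi d (int k * (1 * dot p r + (- 1) * dot p q)) * chi d (- ((\<Sum>i<k. int i) * dot p q))
        * v (lc 1 (lc 1 r (- 1) q) (- int k) q))"
    by (simp add: T_def[of p q "(T p q ^^ k) v"] Suc.IH chi_diff c)
  also have "lc 1 (lc 1 r (- 1) q) (- int k) q = lc 1 r (- int (Suc k)) q"
    by (simp add: lc_lc_left)
  finally show ?case by (simp add: algebra_simps flip: chi_add)
qed

text \<open>The number d (d - 1) / 2 is a multiple of d for odd d only; for d = 2 the scalar can be
  -1. Keeping it treats all primes alike.\<close>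

lemma T_power_d:
  assumes "r < D"
  shows "(T p q ^^ d) v r = chi d (- ((\<Sum>i<d. int i) * dot p q)) * v r"
proof -
  have "lc 1 r (- int d) q = lc 1 r 0 q" by (intro lc_cong) (auto simp: cong_0_iff)
  moreover have "chi d (int d * dot p r - (\<Sum>i<d. int i) * dot p q) = chi d (- ((\<Sum>i<d. int i) * dot p q))"
    by (intro chi_cong) (auto simp: cong_iff_dvd_diff)
  ultimately show ?thesis using assms by (simp add: T_power lc_1_0)
qed

section \<open>Eigenvectors of Weyl operators\<close>

definition eigenfun :: "nat \<Rightarrow> nat \<Rightarrow> (nat \<Rightarrow> complex) \<Rightarrow> bool" where
  "eigenfun p q v \<longleftrightarrow> (\<exists>c. \<forall>r<D. T p q v r = c * v r)"

lemma sum_norm_T: "(\<Sum>r<D. (cmod (T p q v r))\<^sup>2) = (\<Sum>r<D. (cmod (v r))\<^sup>2)"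
  unfolding T_def norm_mult norm_chi mult_1_left
  by (rule sum_lc_left[OF unit_1, of "\<lambda>r. (cmod (v r))\<^sup>2"])

text \<open>A Weyl translation only multiplies the eigenvalue by a root of unity, so all translates
  of a state share its eigenlabels.\<close>

lemma eigenfun_T:
  assumes "eigenfun p q v"
  shows "eigenfun p q (T p' q' v)"
proof -
  obtain c where c: "\<And>r. r < D \<Longrightarrow> T p q v r = c * v r"
    using assms by (auto simp: eigenfun_def)
  have "T p q (T p' q' v) r = (chi d (dot p q' - dot p' q) * c) * T p' q' v r" for r
  proof -
    have "T p' q' (T p q v) r = T p' q' (\<lambda>r. c * v r) r" by (rule T_cong) (rule c)
    then show ?thesis by (simp add: T_commute[of p q] T_scale)
  qed
  then show ?thesis unfolding eigenfun_def by blast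
qed

lemma cf_outer:
  assumes "v \<in> carrier_vec D"
  shows "cf (outer v) p q = (\<Sum>r<D. T p q (($) v) r * cnj (v $ r))"
  using assms by (auto simp: cf_def T_def outer_def mult_ac intro!: sum.cong)

text \<open>\<open>cf (outer v) p q\<close> is the expectation a of T in the unit vector
  \<open>v\<close>, and expanding the square gives ||T v - a v||^2 = 1 - |a|^2. This is the equality
  case of Cauchy-Schwarz.\<close>

lemma norm_cf_outer_eq_1_iff:
  assumes v: "v \<in> carrier_vec D" and nv: "(\<Sum>i<D. (cmod (v $ i))\<^sup>2) = 1"
  shows "cmod (cf (outer v) p q) = 1 \<longleftrightarrow> eigenfun p q (($) v)"
proof
  assume "eigenfun p q (($) v)"
  then obtain c where c: "\<And>r. r < D \<Longrightarrow> T p q (($) v) r = c * v $ r"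
    by (auto simp: eigenfun_def)
  have "cf (outer v) p q = c * of_real (\<Sum>i<D. (cmod (v $ i))\<^sup>2)"
    unfolding cf_outer[OF v] of_real_sum complex_norm_square sum_distrib_left
    by (intro sum.cong refl) (simp add: c)
  then have "cf (outer v) p q = c" by (simp add: nv)
  moreover have "1 = (\<Sum>r<D. (cmod (T p q (($) v) r))\<^sup>2)" using nv by (simp add: sum_norm_T)
  then have "1 = (cmod c)\<^sup>2 * (\<Sum>r<D. (cmod (v $ r))\<^sup>2)"
    by (simp add: c norm_mult power_mult_distrib sum_distrib_left)
  then have "cmod c = 1" using nv by (simp add: power2_eq_1_iff) (smt (verit) norm_ge_zero)
  ultimately show "cmod (cf (outer v) p q) = 1" by simp
next
  assume 1: "cmod (cf (outer v) p q) = 1"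
  define a where "a = cf (outer v) p q"
  have aa: "a * cnj a = 1" using 1 complex_norm_square[of a] by (simp add: a_def)
  let ?t = "T p q (($) v)"
  have "of_real (\<Sum>r<D. (cmod (?t r - a * v $ r))\<^sup>2)
      = (\<Sum>r<D. of_real ((cmod (?t r))\<^sup>2) - cnj a * (?t r * cnj (v $ r))
          - a * cnj (?t r * cnj (v $ r)) + a * cnj a * of_real ((cmod (v $ r))\<^sup>2))"
    unfolding of_real_sum complex_norm_square
    by (intro sum.cong refl) (simp add: algebra_simps)
  also have "\<dots> = of_real (\<Sum>r<D. (cmod (?t r))\<^sup>2) - cnj a * a - a * cnj a
      + a * cnj a * of_real (\<Sum>r<D. (cmod (v $ r))\<^sup>2)"
    unfolding of_real_sum a_def cf_outer[OF v] cnj_sum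
    by (simp only: sum.distrib sum_subtractf sum_distrib_left)
  also have "\<dots> = 0" unfolding sum_norm_T nv using aa by (simp add: mult.commute)
  finally have "(\<Sum>r<D. (cmod (?t r - a * v $ r))\<^sup>2) = 0" by (simp only: of_real_eq_0_iff)
  then have "\<forall>r<D. ?t r = a * v $ r" by (subst (asm) sum_nonneg_eq_0_iff) auto
  then show "eigenfun p q (($) v)" unfolding eigenfun_def by blast
qed

text \<open>On a common eigenvector both orders multiply by the same number, nonzero because T
  preserves norms, so the commutation factor is 1.\<close>

lemma eigenfuns_commute:
  assumes "eigenfun p q v" "eigenfun p' q' v" and nz: "r < D" "v r \<noteq> 0"
  shows "chi d (dot p q' - dot p' q) = 1"
proof -
  obtain c where c: "\<And>r. r < D \<Longrightarrow> T p q v r = c * v r" using assms(1) by (auto simp: eigenfun_def)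
  obtain c' where c': "\<And>r. r < D \<Longrightarrow> T p' q' v r = c' * v r" using assms(2) by (auto simp: eigenfun_def)
  have nz': "e \<noteq> 0" if e: "\<And>r. r < D \<Longrightarrow> T x y v r = e * v r" for e x y
  proof
    assume "e = 0"
    then have "(\<Sum>r<D. (cmod (T x y v r))\<^sup>2) = 0" using e by simp
    then have "(\<Sum>r<D. (cmod (v r))\<^sup>2) = 0" by (simp only: sum_norm_T)
    then show False using nz by (subst (asm) sum_nonneg_eq_0_iff) auto
  qed
  have "T p q (T p' q' v) r = T p q (\<lambda>r. c' * v r) r" by (rule T_cong) (rule c')
  then have 1: "T p q (T p' q' v) r = c' * (c * v r)" using c nz(1) by (simp add: T_scale)
  have "T p' q' (T p q v) r = T p' q' (\<lambda>r. c * v r) r" by (rule T_cong) (rule c)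
  then have 2: "T p' q' (T p q v) r = c * (c' * v r)" using c' nz(1) by (simp add: T_scale)
  have "c' * (c * v r) = chi d (dot p q' - dot p' q) * (c * (c' * v r))"
    using T_commute[of p q p' q' v r] unfolding 1 2 .
  then show ?thesis using nz(2) nz'[OF c] nz'[OF c'] by simp
qed

lemma eigenfun_vadd:
  assumes "eigenfun p q v" "eigenfun p' q' v"
  shows "eigenfun (vadd d n p p') (vadd d n q q') v"
proof -
  obtain c where c: "\<And>r. r < D \<Longrightarrow> T p q v r = c * v r" using assms(1) by (auto simp: eigenfun_def)
  obtain c' where c': "\<And>r. r < D \<Longrightarrow> T p' q' v r = c' * v r" using assms(2) by (auto simp: eigenfun_def)
  have "T p q (T p' q' v) r = c' * (c * v r)" if "r < D" for r
  proof -
    have "T p q (T p' q' v) r = T p q (\<lambda>r. c' * v r) r" by (rule T_cong) (rule c')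
    then show ?thesis using c that by (simp add: T_scale)
  qed
  then have "\<forall>r<D. T (vadd d n p p') (vadd d n q q') v r = (chi d (dot p' q) * c' * c) * v r"
    by (simp add: T_add)
  then show ?thesis unfolding eigenfun_def by blast
qed

text \<open>Averaging \<open>c\<^sup>-\<^sup>k T\<^sup>k \<phi>\<close> over \<open>k < d\<close> projects onto the eigenspace of \<open>c\<close>,
  where \<open>c\<close> ranges over the \<open>d\<close>-th roots of the scalar \<open>T\<^sup>d\<close>; the projections sum to \<open>d \<phi>\<close>,
  so one of them is nonzero.\<close>

lemma common_eigenfun:
  assumes "finite F"
    and "\<And>p q p' q'. (p,q) \<in> F \<Longrightarrow> (p',q') \<in> F \<Longrightarrow> chi d (dot p q' - dot p' q) = 1"
  shows "\<exists>\<phi>. (\<exists>r<D. \<phi> r \<noteq> 0) \<and> (\<forall>(p,q)\<in>F. eigenfun p q \<phi>)"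
  using assms
proof (induction F rule: finite_induct)
  case empty
  show ?case by (rule exI[of _ "\<lambda>_. 1"]) (auto intro!: exI[of _ 0])
next
  case (insert x F)
  obtain p q where x: "x = (p,q)" by (cases x)
  obtain \<phi> r0 where r0: "r0 < D" "\<phi> r0 \<noteq> 0" and \<phi>: "\<And>p q. (p,q) \<in> F \<Longrightarrow> eigenfun p q \<phi>"
    using insert.IH insert.prems by blast
  define m where "m = - ((\<Sum>i<d. int i) * dot p q)"
  define \<mu> where "\<mu> = cis (2 * pi * of_int m / of_nat d / of_nat d)"
  define c where "c j = \<mu> * chi d (int j)" for j
  have c0: "c j \<noteq> 0" for j by (simp add: c_def \<mu>_def)
  have cd: "c j ^ d = chi d m" for j
  proof -
    have "\<mu> ^ d = chi d m" by (simp add: \<mu>_def chi_def DeMoivre)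
    moreover have "chi d (int j) ^ d = 1"
      unfolding chi_of_nat_mult[symmetric] by (subst chi_eq_1_iff) auto
    ultimately show ?thesis by (simp add: c_def power_mult_distrib)
  qed
  define A where "A k = (T p q ^^ k) \<phi>" for k
  have A0: "A 0 = \<phi>" by (simp add: A_def)
  have AS: "T p q (A k) = A (Suc k)" for k by (simp add: A_def)
  have Ad: "A d r = chi d m * \<phi> r" if "r < D" for r
    using T_power_d[OF that] by (simp add: A_def m_def)
  define \<psi> where "\<psi> j r = (\<Sum>k<d. (1 / c j ^ k) * A k r)" for j r
  have eig: "eigenfun p q (\<psi> j)" for j
    unfolding eigenfun_def
  proof (intro exI allI impI)
    fix r assume r: "r < D"
    have "T p q (\<psi> j) r = (\<Sum>k<d. (1 / c j ^ k) * A (Suc k) r)"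
      unfolding \<psi>_def by (simp only: T_sum T_scale AS)
    also have "\<dots> = c j * (\<Sum>k<d. (1 / c j ^ Suc k) * A (Suc k) r)"
      unfolding sum_distrib_left by (intro sum.cong refl) (simp add: c0)
    \<comment> \<open>The shifted sum drops the term for \<open>k = 0\<close>, which is
      \<open>\<phi> r\<close>, and gains the one for \<open>k = d\<close>, which is
      \<open>\<phi> r\<close> again since \<open>c j ^ d = chi d m\<close>.\<close>
    also have "(\<Sum>k<d. (1 / c j ^ Suc k) * A (Suc k) r)
        = (\<Sum>k<Suc d. (1 / c j ^ k) * A k r) - \<phi> r"
      by (subst sum.lessThan_Suc_shift) (simp add: A0)
    also have "\<dots> = \<psi> j r" using r by (simp add: \<psi>_def cd Ad)
    finally show "T p q (\<psi> j) r = c j * \<psi> j r" .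
  qed
  have other: "eigenfun p' q' (\<psi> j)" if y: "(p',q') \<in> F" for p' q' j
  proof -
    obtain e where e: "\<And>r. r < D \<Longrightarrow> T p' q' \<phi> r = e * \<phi> r"
      using \<phi>[OF y] by (auto simp: eigenfun_def)
    have comm: "chi d (dot p' q - dot p q') = 1" using insert.prems[of p' q' p q] y x by simp
    \<comment> \<open>The two operators commute, so every power keeps the eigenvalue
      \<open>e\<close>, and so does any linear combination of them.\<close>
    have Ae: "T p' q' (A k) r = e * A k r" if "r < D" for k r
      using that
    proof (induction k arbitrary: r)
      case 0
      then show ?case by (simp add: A0 e)
    next
      case (Suc k)
      have "T p' q' (A (Suc k)) r = T p q (T p' q' (A k)) r"
        unfolding AS[symmetric] T_commute[of p' q'] comm by simp
      also have "\<dots> = T p q (\<lambda>r. e * A k r) r" by (rule T_cong) (rule Suc.IH)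
      finally show ?case by (simp add: T_scale AS)
    qed
    have "T p' q' (\<psi> j) r = e * \<psi> j r" if "r < D" for r
    proof -
      have "T p' q' (\<psi> j) r = (\<Sum>k<d. (1 / c j ^ k) * T p' q' (A k) r)"
        unfolding \<psi>_def by (simp only: T_sum T_scale)
      then show ?thesis by (simp add: Ae that \<psi>_def sum_distrib_left mult_ac)
    qed
    then show ?thesis unfolding eigenfun_def by blast
  qed
  have "\<exists>j<d. \<psi> j r0 \<noteq> 0"
  proof (rule ccontr)
    assume "\<not> ?thesis"
    then have "0 = (\<Sum>j<d. \<psi> j r0)" by simp
    also have "\<dots> = (\<Sum>k<d. \<Sum>j<d. (1 / c j ^ k) * A k r0)"
      unfolding \<psi>_def by (rule sum.swap)
    \<comment> \<open>Summing over the roots first leaves only \<open>k = 0\<close>, by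
      orthogonality of characters of Z_d.\<close>
    also have "\<dots> = (\<Sum>k<d. (\<Sum>j<d. chi d (- (int k * int j))) * (A k r0 / \<mu> ^ k))"
    proof (rule sum.cong[OF refl])
      fix k
      have "1 / c j ^ k = chi d (- (int k * int j)) / \<mu> ^ k" for j
      proof -
        have "chi d (- (int k * int j)) * chi d (int j) ^ k = 1"
          unfolding chi_of_nat_mult[symmetric] chi_add[symmetric] by simp
        then show ?thesis by (simp add: c_def power_mult_distrib field_simps \<mu>_def)
      qed
      then show "(\<Sum>j<d. (1 / c j ^ k) * A k r0)
          = (\<Sum>j<d. chi d (- (int k * int j))) * (A k r0 / \<mu> ^ k)"
        by (simp add: sum_distrib_right sum_divide_distrib)
    qed
    also have "\<dots> = (\<Sum>k<d. if k = 0 then of_nat d * \<phi> r0 else 0)"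
      by (intro sum.cong refl) (auto simp: sum_chi_mult A0)
    also have "\<dots> = of_nat d * \<phi> r0" by simp
    finally show False using r0 d_pos by simp
  qed
  then obtain j where "\<psi> j r0 \<noteq> 0" by blast
  then show ?case using r0 eig other x by (intro exI[of _ "\<psi> j"]) auto
qed

section \<open>From Weyl matrices to phase-free operators\<close>

text \<open>Only \<open>ph_nonzero\<close> is ever used of this factor, so its different form for d
  = 2 never comes up.\<close>

definition ph :: "nat \<Rightarrow> nat \<Rightarrow> complex" where
  "ph p q = (\<Prod>k<n. weyl_phase d (digit d k p) (digit d k q))"

lemma ph_nonzero: "ph p q \<noteq> 0"
  by (auto simp: ph_def weyl_phase_def)

text \<open>\<open>weyl1\<close> states the shift as row = column + q in each digit;
  \<open>T\<close> needs the column as a function of the row.\<close>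

lemma eq_lc_sub_iff:
  assumes "r < D" "c < D"
  shows "c = lc 1 r (- 1) q \<longleftrightarrow> (\<forall>k<n. digit d k r = (digit d k c + digit d k q) mod d)"
proof -
  have "c = lc 1 r (- 1) q \<longleftrightarrow> r = lc 1 c 1 q"
    using assms by (auto simp: lc_lc_left lc_1_0)
  also have "\<dots> \<longleftrightarrow> (\<forall>k<n. digit d k r = digit d k (lc 1 c 1 q))"
    using assms index_eqI[of r "lc 1 c 1 q"] by auto
  also have "\<dots> \<longleftrightarrow> (\<forall>k<n. digit d k r = (digit d k c + digit d k q) mod d)"
  proof -
    have "digit d k (lc 1 c 1 q) = (digit d k c + digit d k q) mod d" if "k < n" for k
    proof -
      have "int (digit d k (lc 1 c 1 q)) = int ((digit d k c + digit d k q) mod d)"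
        using that by (simp add: digit_lc zmod_int)
      then show ?thesis by simp
    qed
    then show ?thesis by simp
  qed
  finally show ?thesis .
qed

lemma weyl_entry:
  assumes "r < D" "c < D"
  shows "weyl d n p q $$ (r,c) = (if c = lc 1 r (- 1) q then ph p q * chi d (dot p r) else 0)"
proof -
  have "weyl d n p q $$ (r,c) = (\<Prod>k<n. if digit d k r = (digit d k c + digit d k q) mod d
      then weyl_phase d (digit d k p) (digit d k q) * chi d (int (digit d k p) * int (digit d k r)) else 0)"
    using assms by (simp add: weyl_def weyl1_def digit_less)
  also have "\<dots> = (if c = lc 1 r (- 1) q then ph p q * chi d (dot p r) else 0)"
  proof (cases "c = lc 1 r (- 1) q")
    case True
    then have "\<forall>k<n. digit d k r = (digit d k c + digit d k q) mod d"
      using eq_lc_sub_iff[OF assms] by blast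
    then have "(\<Prod>k<n. if digit d k r = (digit d k c + digit d k q) mod d
      then weyl_phase d (digit d k p) (digit d k q) * chi d (int (digit d k p) * int (digit d k r)) else 0)
      = (\<Prod>k<n. weyl_phase d (digit d k p) (digit d k q) * chi d (int (digit d k p) * int (digit d k r)))"
      by (intro prod.cong refl) (metis lessThan_iff)
    also have "\<dots> = ph p q * chi d (dot p r)"
      by (simp add: ph_def dot_def chi_sum prod.distrib)
    finally show ?thesis using True by simp
  next
    case False
    then obtain k where "k < n" "digit d k r \<noteq> (digit d k c + digit d k q) mod d"
      using eq_lc_sub_iff[OF assms] by blast
    then show ?thesis using False by (auto intro!: prod_zero bexI[of _ k])
  qed
  finally show ?thesis .
qed

lemma weyl_carrier: "weyl d n p q \<in> carrier_mat D D"
  by (simp add: weyl_def)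

lemma weyl_mult_vec_entry:
  assumes "v \<in> carrier_vec D" "r < D"
  shows "(weyl d n p q *\<^sub>v v) $ r = ph p q * T p q (($) v) r"
proof -
  have "(weyl d n p q *\<^sub>v v) $ r = (\<Sum>c<D. weyl d n p q $$ (r,c) * v $ c)"
    using assms weyl_carrier[of p q] by (auto simp: scalar_prod_def atLeast0LessThan intro!: sum.cong)
  also have "\<dots> = (\<Sum>c<D. if c = lc 1 r (- 1) q then ph p q * T p q (($) v) r else 0)"
    using assms by (intro sum.cong refl) (auto simp: weyl_entry T_def)
  finally show ?thesis by simp
qed

lemma weyl_eigenvector_iff:
  assumes v: "v \<in> carrier_vec D"
  shows "(\<exists>c. weyl d n p q *\<^sub>v v = c \<cdot>\<^sub>v v) \<longleftrightarrow> eigenfun p q (($) v)"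
proof
  assume "\<exists>c. weyl d n p q *\<^sub>v v = c \<cdot>\<^sub>v v"
  then obtain c where c: "weyl d n p q *\<^sub>v v = c \<cdot>\<^sub>v v" by blast
  have "T p q (($) v) r = (c / ph p q) * v $ r" if "r < D" for r
  proof -
    have "ph p q * T p q (($) v) r = c * v $ r"
      using weyl_mult_vec_entry[OF v that, of p q] v that unfolding c by simp
    then show ?thesis using ph_nonzero[of p q] by (simp add: field_simps)
  qed
  then show "eigenfun p q (($) v)" unfolding eigenfun_def by blast
next
  assume "eigenfun p q (($) v)"
  then obtain c where "\<And>r. r < D \<Longrightarrow> T p q (($) v) r = c * v $ r" by (auto simp: eigenfun_def)
  then have "weyl d n p q *\<^sub>v v = (ph p q * c) \<cdot>\<^sub>v v"
    using v weyl_carrier[of p q] by (intro eq_vecI) (auto simp: weyl_mult_vec_entry simp del: index_mult_mat_vec)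
  then show "\<exists>c. weyl d n p q *\<^sub>v v = c \<cdot>\<^sub>v v" by blast
qed

lemma weyl_mult_entry:
  assumes "r < D" "c < D"
  shows "(weyl d n p q * weyl d n p' q') $$ (r,c) = (if c = lc 1 (lc 1 r (- 1) q) (- 1) q'
    then ph p q * ph p' q' * chi d (dot p r + dot p' r - dot p' q) else 0)"
proof -
  have "(weyl d n p q * weyl d n p' q') $$ (r,c)
      = (\<Sum>t<D. weyl d n p q $$ (r,t) * weyl d n p' q' $$ (t,c))"
    by (rule mult_mat_entry[OF weyl_carrier weyl_carrier assms])
  also have "\<dots> = (\<Sum>t<D. if t = lc 1 r (- 1) q
      then ph p q * chi d (dot p r) * weyl d n p' q' $$ (lc 1 r (- 1) q, c) else 0)"
    using assms by (intro sum.cong refl) (auto simp: weyl_entry)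
  also have "\<dots> = ph p q * chi d (dot p r) * weyl d n p' q' $$ (lc 1 r (- 1) q, c)" by simp
  finally show ?thesis using assms by (simp add: weyl_entry chi_dot_lc chi_add chi_diff mult_ac)
qed

lemma weyl_commute:
  assumes "chi d (dot p q' - dot p' q) = 1"
  shows "weyl d n p q * weyl d n p' q' = weyl d n p' q' * weyl d n p q"
proof (rule eq_matI)
  fix r c assume "r < dim_row (weyl d n p' q' * weyl d n p q)" "c < dim_col (weyl d n p' q' * weyl d n p q)"
  then have rc: "r < D" "c < D" using weyl_carrier[of p q] weyl_carrier[of p' q'] by auto
  have "dot p r + dot p' r - dot p' q = (dot p q' - dot p' q) + (dot p' r + dot p r - dot p q')"
    by simp
  then have "chi d (dot p r + dot p' r - dot p' q) = chi d (dot p' r + dot p r - dot p q')"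
    unfolding chi_add[of d "dot p q' - dot p' q"] using assms by (metis chi_add mult_1)
  then show "(weyl d n p q * weyl d n p' q') $$ (r,c) = (weyl d n p' q' * weyl d n p q) $$ (r,c)"
    unfolding weyl_mult_entry[OF rc] lc_sub_sub_commute[of r q' q] by (simp add: mult_ac)
qed (use weyl_carrier[of p q] weyl_carrier[of p' q'] in auto)

end

section \<open>Holevo capacity\<close>

definition ensemble_mean :: "nat \<Rightarrow> nat \<Rightarrow> (nat \<Rightarrow> real) \<Rightarrow> (nat \<Rightarrow> complex mat) \<Rightarrow> complex mat" where
  "ensemble_mean m k p M = mat m m (\<lambda>(r,c). \<Sum>i<k. complex_of_real (p i) * M i $$ (r,c))"

locale state_channel =
  fixes m :: nat and E :: "complex mat \<Rightarrow> complex mat"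
  assumes E_density: "density_op m \<rho> \<Longrightarrow> density_op m (E \<rho>)"
begin

definition holevo_values :: "real set" where
  "holevo_values = {vn_entropy (ensemble_mean m k p (\<lambda>i. E (\<rho> i))) - (\<Sum>i<k. p i * vn_entropy (E (\<rho> i))) | k p \<rho>.
    0 < (k::nat) \<and> (\<forall>i<k. 0 \<le> p i \<and> density_op m (\<rho> i)) \<and> (\<Sum>i<k. p i) = 1}"

lemma holevo_capacity_eq: "holevo_capacity m E = Sup holevo_values"
proof -
  have "(let M = (\<lambda>i. E (\<rho> i)) in
          mat (dim_row (M 0)) (dim_col (M 0)) (\<lambda>(r,c). \<Sum>i<k. complex_of_real (p i) * M i $$ (r,c)))
      = ensemble_mean m k p (\<lambda>i. E (\<rho> i))"
    if "0 < k" "\<forall>i<k. 0 \<le> p i \<and> density_op m (\<rho> i)" for k p \<rho>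
  proof -
    have "E (\<rho> 0) \<in> carrier_mat m m" using that E_density[of "\<rho> 0"] by (simp add: density_op_def)
    then show ?thesis by (simp add: ensemble_mean_def)
  qed
  then show ?thesis
    unfolding holevo_capacity_def holevo_values_def
    by (intro arg_cong[where f = Sup] Collect_cong) (metis (no_types, lifting))
qed

lemma density_op_ensemble_mean:
  assumes "\<forall>i<k. 0 \<le> p i \<and> density_op m (\<rho> i)" "(\<Sum>i<k. p i) = 1"
  shows "density_op m (ensemble_mean m k p (\<lambda>i. E (\<rho> i)))"
  unfolding ensemble_mean_def using assms by (intro density_op_mixture) (auto intro: E_density)

lemma holevo_values_le:
  assumes "x \<in> holevo_values"
  shows "x \<le> ln (real m)"
proof -
  obtain k p \<rho> where x: "x = vn_entropy (ensemble_mean m k p (\<lambda>i. E (\<rho> i))) - (\<Sum>i<k. p i * vn_entropy (E (\<rho> i)))"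
    and en: "\<forall>i<k. 0 \<le> p i \<and> density_op m (\<rho> i)" "(\<Sum>i<k. p i) = 1"
    using assms unfolding holevo_values_def by blast
  have "0 \<le> (\<Sum>i<k. p i * vn_entropy (E (\<rho> i)))"
    using en(1) by (intro sum_nonneg mult_nonneg_nonneg) (auto intro: vn_entropy_nonneg E_density)
  moreover have "vn_entropy (ensemble_mean m k p (\<lambda>i. E (\<rho> i))) \<le> ln (real m)"
    by (rule vn_entropy_le_ln_dim[OF density_op_ensemble_mean[OF en]])
  ultimately show ?thesis using x by simp
qed

text \<open>The entropy of the mean is at most ln m, so an ensemble within \<epsilon> of the
  supremum has average output entropy below \<epsilon>. Some output is then below \<epsilon> too,
  and entropy dominates impurity.\<close>

lemma maximal_holevo_capacity_imp_nearly_pure: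
  assumes cap: "holevo_capacity m E = ln (real m)" and \<epsilon>: "\<epsilon> > 0" and \<rho>0: "density_op m \<rho>0"
  obtains \<rho> where "density_op m \<rho>" "purity m (E \<rho>) > 1 - \<epsilon>"
proof -
  \<comment> \<open>The one-state ensemble of \<open>\<rho>0\<close> shows that the set of values is
    nonempty, so that its \<open>Sup\<close> can be approximated by members.\<close>
  have "vn_entropy (ensemble_mean m 1 (\<lambda>_. 1) (\<lambda>i. E \<rho>0)) - (\<Sum>i<1::nat. 1 * vn_entropy (E \<rho>0)) \<in> holevo_values"
    unfolding holevo_values_def using \<rho>0
    by (intro CollectI exI[of _ 1] exI[of _ "\<lambda>_. 1"] exI[of _ "\<lambda>_. \<rho>0"]) auto
  then have "holevo_values \<noteq> {}" by blast
  moreover have "ln (real m) - \<epsilon> < Sup holevo_values" using cap \<epsilon> by (simp add: holevo_capacity_eq)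
  ultimately obtain x where "x \<in> holevo_values" and big: "ln (real m) - \<epsilon> < x"
    using less_cSupD by blast
  then obtain k p \<rho> where x: "x = vn_entropy (ensemble_mean m k p (\<lambda>i. E (\<rho> i))) - (\<Sum>i<k. p i * vn_entropy (E (\<rho> i)))"
    and en: "\<forall>i<k. 0 \<le> p i \<and> density_op m (\<rho> i)" "(\<Sum>i<k. p i) = 1"
    unfolding holevo_values_def by blast
  have "vn_entropy (ensemble_mean m k p (\<lambda>i. E (\<rho> i))) \<le> ln (real m)"
    by (rule vn_entropy_le_ln_dim[OF density_op_ensemble_mean[OF en]])
  then have small: "(\<Sum>i<k. p i * vn_entropy (E (\<rho> i))) < \<epsilon>" using x big by simp
  have "\<exists>i<k. vn_entropy (E (\<rho> i)) < \<epsilon>"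
  proof (rule ccontr)
    assume "\<not> ?thesis"
    then have "\<forall>i<k. \<epsilon> \<le> vn_entropy (E (\<rho> i))" by (meson not_less)
    then have "(\<Sum>i<k. p i * \<epsilon>) \<le> (\<Sum>i<k. p i * vn_entropy (E (\<rho> i)))"
      using en(1) by (intro sum_mono mult_left_mono) (simp_all add: not_less)
    moreover have "(\<Sum>i<k. p i * \<epsilon>) = \<epsilon>" using en(2) by (simp flip: sum_distrib_right)
    ultimately show False using small by simp
  qed
  then obtain i where i: "i < k" "vn_entropy (E (\<rho> i)) < \<epsilon>" by blast
  then have "density_op m (\<rho> i)" using en(1) by blast
  moreover from vn_entropy_ge_1_minus_purity[OF E_density[OF this]] i(2)
  have "purity m (E (\<rho> i)) > 1 - \<epsilon>" by simp
  ultimately show ?thesis by (rule that)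
qed

lemma maximal_holevo_capacityI:
  assumes "m > 0" "0 < k" "\<forall>i<k. 0 \<le> p i \<and> density_op m (\<rho> i)" "(\<Sum>i<k. p i) = 1"
    and pure: "\<And>i. i < k \<Longrightarrow> purity m (E (\<rho> i)) = 1"
    and mean: "ensemble_mean m k p (\<lambda>i. E (\<rho> i)) = mat m m (\<lambda>(i,j). if i = j then of_real (1 / real m) else 0)"
  shows "holevo_capacity m E = ln (real m)"
proof -
  have "vn_entropy (E (\<rho> i)) = 0" if "i < k" for i
    using assms(3) that pure by (intro vn_entropy_pure[of m] E_density) auto
  then have "vn_entropy (ensemble_mean m k p (\<lambda>i. E (\<rho> i))) - (\<Sum>i<k. p i * vn_entropy (E (\<rho> i))) = ln (real m)"
    unfolding mean vn_entropy_maximally_mixed[OF assms(1)] by simp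
  then have "ln (real m) \<in> holevo_values"
    unfolding holevo_values_def using assms(2-4)
    by (intro CollectI exI[of _ k] exI[of _ p] exI[of _ \<rho>]) auto
  then show ?thesis unfolding holevo_capacity_eq by (rule cSup_eq_maximum) (rule holevo_values_le)
qed

end

section \<open>The two directions of the equivalence\<close>

context qudit_convolution
begin

lemma sum_smul:
  fixes F :: "nat \<Rightarrow> nat \<Rightarrow> 'a :: comm_monoid_add"
  assumes "\<not> [\<alpha> = 0] (mod int d)" "\<not> [\<beta> = 0] (mod int d)"
  shows "(\<Sum>p<D. \<Sum>q<D. F (smul \<alpha> p) (smul \<beta> q)) = (\<Sum>p<D. \<Sum>q<D. F p q)"
proof -
  have "(\<Sum>p<D. \<Sum>q<D. F (smul \<alpha> p) (smul \<beta> q)) = (\<Sum>p<D. \<Sum>q<D. F (smul \<alpha> p) q)"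
    by (rule sum.cong[OF refl]) (rule sum_lc_left[OF assms(2), of "F (smul \<alpha> _)"])
  also have "\<dots> = (\<Sum>p<D. \<Sum>q<D. F p q)"
    by (rule sum_lc_left[OF assms(1), of "\<lambda>p. \<Sum>q<D. F p q"])
  finally show ?thesis .
qed

lemma units: "\<not> [N * g11 = 0] (mod int d)" "\<not> [- (N * g10) = 0] (mod int d)"
  using unit_mult[OF N_unit g11] unit_mult[OF N_unit g10] by (auto simp: cong_0_iff)

lemma purity_conv:
  "real D * purity D (conv \<rho> \<sigma>) = (\<Sum>p<D. \<Sum>q<D.
    (cmod (cf \<rho> (smul (N * g11) p) (smul g00 q)))\<^sup>2 *
    (cmod (cf \<sigma> (smul (- (N * g10)) p) (smul g01 q)))\<^sup>2)"
  unfolding sum_cf_square[symmetric]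
  by (intro sum.cong refl) (simp add: cf_conv norm_mult power_mult_distrib)

text \<open>Pointwise, \<open>s (1 - s) \<le> r (1 - s) + s (1 - r)\<close> for \<open>r, s \<in> [0, 1]\<close>; summed over phase space,
  the right-hand side is at most \<open>2 D (1 - purity)\<close>.\<close>

lemma sum_cf_defect_le:
  assumes \<rho>: "density_op D \<rho>" and \<sigma>: "density_op D \<sigma>"
  shows "(\<Sum>p<D. \<Sum>q<D. (cmod (cf \<sigma> p q))\<^sup>2 * (1 - (cmod (cf \<sigma> p q))\<^sup>2))
    \<le> 2 * real D * (1 - purity D (conv \<rho> \<sigma>))"
proof -
  define R where "R p q = (cmod (cf \<rho> (smul (N * g11) p) (smul g00 q)))\<^sup>2" for p q
  define S where "S p q = (cmod (cf \<sigma> (smul (- (N * g10)) p) (smul g01 q)))\<^sup>2" for p q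
  have R: "0 \<le> R p q" "R p q \<le> 1" and S: "0 \<le> S p q" "S p q \<le> 1" for p q
    using norm_cf_le_1[OF \<rho>] norm_cf_le_1[OF \<sigma>] by (auto simp: R_def S_def abs_square_le_1)
  have "(\<Sum>p<D. \<Sum>q<D. (cmod (cf \<sigma> p q))\<^sup>2 * (1 - (cmod (cf \<sigma> p q))\<^sup>2)) = (\<Sum>p<D. \<Sum>q<D. S p q * (1 - S p q))"
    unfolding S_def
    by (rule sum_smul[OF units(2) g01, of "\<lambda>p q. (cmod (cf \<sigma> p q))\<^sup>2 * (1 - (cmod (cf \<sigma> p q))\<^sup>2)", symmetric])
  also have "\<dots> \<le> (\<Sum>p<D. \<Sum>q<D. R p q + S p q - 2 * (R p q * S p q))"
  proof (intro sum_mono)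
    fix p q
    \<comment> \<open>The two products add up to R - 2 R S + S^2, which is exactly the difference of
      the two sides.\<close>
    have "0 \<le> R p q * (1 - S p q) * (1 - S p q)" "0 \<le> S p q * (1 - R p q) * S p q"
      using R[of p q] S[of p q] by simp_all
    then show "S p q * (1 - S p q) \<le> R p q + S p q - 2 * (R p q * S p q)"
      by (simp add: algebra_simps)
  qed
  also have "\<dots> = (\<Sum>p<D. \<Sum>q<D. R p q) + (\<Sum>p<D. \<Sum>q<D. S p q) - 2 * (\<Sum>p<D. \<Sum>q<D. R p q * S p q)"
    by (simp add: sum.distrib sum_subtractf sum_distrib_left)
  also have "(\<Sum>p<D. \<Sum>q<D. R p q * S p q) = real D * purity D (conv \<rho> \<sigma>)"
    unfolding purity_conv R_def S_def ..
  also have "(\<Sum>p<D. \<Sum>q<D. R p q) = real D * purity D \<rho>"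
    unfolding R_def sum_cf_square[symmetric]
    by (rule sum_smul[OF units(1) g00, of "\<lambda>p q. (cmod (cf \<rho> p q))\<^sup>2"])
  also have "(\<Sum>p<D. \<Sum>q<D. S p q) = real D * purity D \<sigma>"
    unfolding S_def sum_cf_square[symmetric]
    by (rule sum_smul[OF units(2) g01, of "\<lambda>p q. (cmod (cf \<sigma> p q))\<^sup>2"])
  also have "real D * purity D \<rho> + real D * purity D \<sigma> - 2 * (real D * purity D (conv \<rho> \<sigma>))
      \<le> real D * 1 + real D * 1 - 2 * (real D * purity D (conv \<rho> \<sigma>))"
    by (intro diff_right_mono add_mono mult_left_mono purity_le_1 \<rho> \<sigma>) simp_all
  finally show ?thesis by (simp add: algebra_simps)
qed

lemma stabilizer_state_if_nearly_pure_outputs: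
  assumes v: "v \<in> carrier_vec D" and nv: "(\<Sum>i<D. (cmod (v $ i))\<^sup>2) = 1"
    and near: "\<And>\<epsilon>. \<epsilon> > 0 \<Longrightarrow> \<exists>\<rho>. density_op D \<rho> \<and> purity D (conv \<rho> (outer v)) > 1 - \<epsilon>"
  shows "stabilizer_state d n v"
proof -
  define s where "s p q = (cmod (cf (outer v) p q))\<^sup>2" for p q
  have \<sigma>: "density_op D (outer v)" by (rule density_op_outer[OF v nv])
  have s: "0 \<le> s p q" "s p q \<le> 1" for p q
    using norm_cf_le_1[OF \<sigma>] by (auto simp: s_def abs_square_le_1)
  \<comment> \<open>The left-hand side does not depend on the input, which may change with
    \<open>e\<close>. The tolerance \<open>e / (2 * real D)\<close> cancels the factor in
    \<open>sum_cf_defect_le\<close>.\<close>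
  have "(\<Sum>p<D. \<Sum>q<D. s p q * (1 - s p q)) \<le> 0 + e" if e: "e > 0" for e
  proof -
    have "e / (2 * real D) > 0" using e D_pos by simp
    then obtain \<rho> where \<rho>: "density_op D \<rho>" "purity D (conv \<rho> (outer v)) > 1 - e / (2 * real D)"
      using near by blast
    have "(\<Sum>p<D. \<Sum>q<D. s p q * (1 - s p q)) \<le> 2 * real D * (1 - purity D (conv \<rho> (outer v)))"
      unfolding s_def by (rule sum_cf_defect_le[OF \<rho>(1) \<sigma>])
    also have "\<dots> \<le> 2 * real D * (e / (2 * real D))"
      using \<rho>(2) by (intro mult_left_mono) auto
    also have "\<dots> = e" using d_pos by simp
    finally show ?thesis by simp
  qed
  then have "(\<Sum>p<D. \<Sum>q<D. s p q * (1 - s p q)) \<le> 0" by (rule field_le_epsilon)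
  moreover have nn: "0 \<le> s p q * (1 - s p q)" for p q using s[of p q] by simp
  ultimately have "(\<Sum>p<D. \<Sum>q<D. s p q * (1 - s p q)) = 0"
    by (intro antisym sum_nonneg) auto
  then have "\<forall>p<D. \<forall>q<D. s p q * (1 - s p q) = 0"
    using nn by (simp add: sum_nonneg_eq_0_iff sum_nonneg)
  then have s01: "s p q = 0 \<or> s p q = 1" if "p < D" "q < D" for p q using that by force
  define S where "S = {(p,q) \<in> {0..<D} \<times> {0..<D}. s p q = 1}"
  have S_iff: "(p,q) \<in> S \<longleftrightarrow> p < D \<and> q < D \<and> eigenfun p q (($) v)" for p q
    unfolding S_def s_def norm_cf_outer_eq_1_iff[OF v nv, symmetric]
    using power2_eq_1_iff[of "cmod (cf (outer v) p q)"] norm_ge_zero[of "cf (outer v) p q"]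
    by auto
  \<comment> \<open>\<open>s\<close> is the indicator function of \<open>S\<close>, so
    \<open>card S\<close> is its total over all labels, which Parseval evaluates as \<open>D\<close>
    times the purity 1 of sigma.\<close>
  have "(\<Sum>(p,q)\<in>S. s p q) = (\<Sum>_\<in>S. 1)" by (intro sum.cong) (auto simp: S_def)
  then have "real (card S) = (\<Sum>(p,q)\<in>S. s p q)" by simp
  also have "\<dots> = (\<Sum>(p,q)\<in>{..<D} \<times> {..<D}. s p q)"
    using s01 by (intro sum.mono_neutral_left) (auto simp: S_def)
  also have "\<dots> = (\<Sum>p<D. \<Sum>q<D. s p q)" by (rule sum.cartesian_product[symmetric])
  also have "\<dots> = real D" unfolding s_def sum_cf_square purity_outer[OF v nv] by simp
  finally have card: "card S = D" by (simp only: of_nat_eq_iff)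
  have v0: "v \<noteq> 0\<^sub>v D" using nv by auto
  obtain r where r: "r < D" "v $ r \<noteq> 0"
    using v v0 by (metis carrier_vecD eq_vecI index_zero_vec)
  have "eigenfun 0 0 (($) v)"
    unfolding eigenfun_def
  proof (intro exI[of _ 1] allI impI)
    fix r assume "r < D"
    have "lc 1 r (- 1) 0 = lc 1 r 0 0" unfolding lc_def by (simp add: digit_def)
    then show "T 0 0 (($) v) r = 1 * v $ r"
      using \<open>r < D\<close> by (simp add: T_def lc_1_0) (simp add: dot_def digit_def)
  qed
  then have zero: "(0,0) \<in> S" using S_iff d_pos by simp
  have closed: "(vadd d n p p', vadd d n q q') \<in> S \<and>
      weyl d n p q * weyl d n p' q' = weyl d n p' q' * weyl d n p q"
    if "(p,q) \<in> S" "(p',q') \<in> S" for p q p' q'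
  proof
    show "(vadd d n p p', vadd d n q q') \<in> S"
      using that eigenfun_vadd by (auto simp: S_iff vadd_lc)
    show "weyl d n p q * weyl d n p' q' = weyl d n p' q' * weyl d n p q"
      by (rule weyl_commute, rule eigenfuns_commute[where v = "($) v" and r = r])
        (use that r in \<open>auto simp: S_iff\<close>)
  qed
  have eig: "\<exists>c. weyl d n p q *\<^sub>v v = c \<cdot>\<^sub>v v" if "(p,q) \<in> S" for p q
    using that by (simp add: S_iff weyl_eigenvector_iff[OF v])
  show ?thesis
    unfolding stabilizer_state_def
    using v v0 card zero closed eig by (intro conjI exI[of _ S]) (auto simp: S_def)
qed

text \<open>By \<open>purity_conv\<close> it is enough that D of the nonnegative summands equal 1,
  since purity is at most 1. A summand is 1 where both of its labels are eigenlabels, one of the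
  input and one of sigma.\<close>

lemma pure_output_ensemble:
  assumes v: "v \<in> carrier_vec D" and nv: "(\<Sum>i<D. (cmod (v $ i))\<^sup>2) = 1"
    and st: "stabilizer_state d n v"
  obtains \<phi> where "(\<Sum>i<D. (cmod (\<phi> i))\<^sup>2) = 1"
    "\<And>x y. purity D (conv (outer (vec D (T x y \<phi>))) (outer v)) = 1"
proof -
  obtain S where S: "S \<subseteq> {0..<D} \<times> {0..<D}" "card S = D"
    and "\<forall>(p,q)\<in>S. \<exists>c. weyl d n p q *\<^sub>v v = c \<cdot>\<^sub>v v"
    using st unfolding stabilizer_state_def by blast
  then have eig: "eigenfun p q (($) v)" if "(p,q) \<in> S" for p q
    using that weyl_eigenvector_iff[OF v] by blast
  have finS: "finite S" using S(1) finite_subset by blast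
  have "v \<noteq> 0\<^sub>v D" using nv by auto
  then obtain r where r: "r < D" "v $ r \<noteq> 0"
    using v by (metis carrier_vecD eq_vecI index_zero_vec)
  obtain w1 where w1: "[w1 * (- (N * g10)) = 1] (mod int d)" "\<not> [w1 = 0] (mod int d)"
    using unit_inverse[OF units(2)] by blast
  obtain w2 where w2: "[w2 * g01 = 1] (mod int d)" "\<not> [w2 = 0] (mod int d)"
    using unit_inverse[OF g01] by blast
  \<comment> \<open>In \<open>cf_conv\<close> the output label \<open>(smul w1 p, smul w2 q)\<close>
    is the one whose sigma label is \<open>(p, q)\<close>; its input label is then
    \<open>(smul a p, smul b q)\<close>.\<close>
  define a b where "a = N * g11 * w1" and "b = g00 * w2"
  define S' where "S' = (\<lambda>(p,q). (smul a p, smul b q)) ` S"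
  have "chi d (dot p q' - dot p' q) = 1" if "(p,q) \<in> S'" "(p',q') \<in> S'" for p q p' q'
  proof -
    obtain x y x' y' where xy: "(x,y) \<in> S" "p = smul a x" "q = smul b y"
      and xy': "(x',y') \<in> S" "p' = smul a x'" "q' = smul b y'"
      using \<open>(p,q) \<in> S'\<close> \<open>(p',q') \<in> S'\<close> unfolding S'_def by auto
    \<comment> \<open>All p-labels are scaled by \<open>a\<close> and all q-labels by
      \<open>b\<close>, so the symplectic form is multiplied by the constant
      \<open>a * b\<close>.\<close>
    have dot2: "[dot (smul a i) (smul b j) = a * b * dot i j] (mod int d)" for i j
    proof -
      have "[dot (smul a i) (smul b j) = a * dot i (smul b j) + 0 * dot 0 (smul b j)] (mod int d)"
        by (rule dot_lc_left)
      also have "a * dot i (smul b j) + 0 * dot 0 (smul b j) = a * dot i (smul b j)" by simp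
      also have "[a * dot i (smul b j) = a * (b * dot i j + 0 * dot i 0)] (mod int d)"
        by (intro cong_scalar_left dot_lc)
      also have "a * (b * dot i j + 0 * dot i 0) = a * b * dot i j" by simp
      finally show ?thesis .
    qed
    have "chi d (dot x y' - dot x' y) = 1"
      by (rule eigenfuns_commute[OF eig[OF xy(1)] eig[OF xy'(1)] r])
    then have "int d dvd a * b * (dot x y' - dot x' y)" by (simp add: chi_eq_1_iff)
    moreover have "[dot p q' - dot p' q = a * b * (dot x y' - dot x' y)] (mod int d)"
      using cong_diff[OF dot2[of x y'] dot2[of x' y]] xy xy' by (simp add: algebra_simps)
    ultimately show ?thesis by (simp add: chi_eq_1_iff cong_dvd_iff)
  qed
  then obtain \<phi>0 r0 where r0: "r0 < D" "\<phi>0 r0 \<noteq> 0" and \<phi>0: "\<forall>(p,q)\<in>S'. eigenfun p q \<phi>0"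
    using common_eigenfun[of S'] finS unfolding S'_def by blast
  define z where "z = (\<Sum>i<D. (cmod (\<phi>0 i))\<^sup>2)"
  have z: "z > 0"
    unfolding z_def using r0 by (intro sum_pos2[of _ r0]) auto
  define \<phi> where "\<phi> i = of_real (1 / sqrt z) * \<phi>0 i" for i
  have n\<phi>: "(\<Sum>i<D. (cmod (\<phi> i))\<^sup>2) = 1"
  proof -
    have "(\<Sum>i<D. (cmod (\<phi> i))\<^sup>2) = (\<Sum>i<D. (1 / z) * (cmod (\<phi>0 i))\<^sup>2)"
      using z by (intro sum.cong refl) (simp add: \<phi>_def norm_divide power_divide)
    also have "\<dots> = (1 / z) * z" unfolding z_def sum_distrib_left ..
    finally show ?thesis using z by simp
  qed
  have \<phi>: "eigenfun p q \<phi>" if pq: "(p,q) \<in> S'" for p q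
  proof -
    obtain c where "\<forall>r<D. T p q \<phi>0 r = c * \<phi>0 r" using bspec[OF \<phi>0 pq] by (auto simp: eigenfun_def)
    then have "\<forall>r<D. T p q \<phi> r = c * \<phi> r"
      unfolding \<phi>_def by (simp only: T_scale mult.left_commute) simp
    then show ?thesis unfolding eigenfun_def by blast
  qed
  have "purity D (conv (outer (vec D (T x y \<phi>))) (outer v)) = 1" for x y
  proof -
    define u where "u = vec D (T x y \<phi>)"
    have u: "u \<in> carrier_vec D" by (simp add: u_def)
    have nu: "(\<Sum>i<D. (cmod (u $ i))\<^sup>2) = 1"
      using sum_norm_T[of x y \<phi>] n\<phi> by (simp add: u_def)
    have eu: "eigenfun p q (($) u)" if pq: "(p,q) \<in> S'" for p q
    proof -
      obtain c where c: "\<forall>r<D. T p q (T x y \<phi>) r = c * T x y \<phi> r"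
        using eigenfun_T[OF \<phi>[OF pq], of x y] by (auto simp: eigenfun_def)
      have "T p q (($) u) r = T p q (T x y \<phi>) r" for r by (rule T_cong) (simp add: u_def)
      then have "\<forall>r<D. T p q (($) u) r = c * u $ r" using c by (simp add: u_def)
      then show ?thesis unfolding eigenfun_def by blast
    qed
    define F where "F p q = (cmod (cf (outer u) (smul (N * g11) p) (smul g00 q)))\<^sup>2 *
      (cmod (cf (outer v) (smul (- (N * g10)) p) (smul g01 q)))\<^sup>2" for p q
    have F1: "F (smul w1 p) (smul w2 q) = 1" if pq: "(p,q) \<in> S" for p q
    proof -
      have lt: "p < D" "q < D" using pq S(1) by auto
      have smul2: "smul \<alpha> (smul \<beta> i) = smul (\<alpha> * \<beta>) i" for \<alpha> \<beta> i
        using lc_lc_left[of \<alpha> \<beta> i 0 0 0] by simp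
      have 1: "smul (- (N * g10)) (smul w1 p) = p" "smul g01 (smul w2 q) = q"
        unfolding smul2
        using lc_cong[of "- (N * g10) * w1" 1 0 0 p 0] lc_cong[of "g01 * w2" 1 0 0 q 0] w1 w2 lt
        by (simp_all add: lc_1_0 mult.commute)
      have 2: "(smul (N * g11) (smul w1 p), smul g00 (smul w2 q)) \<in> S'"
        unfolding smul2 S'_def a_def b_def using pq by force
      show ?thesis
        unfolding F_def 1 iffD2[OF norm_cf_outer_eq_1_iff[OF u nu] eu[OF 2]]
          iffD2[OF norm_cf_outer_eq_1_iff[OF v nv] eig[OF pq]]
        by simp
    qed
    have "real D = (\<Sum>(p,q)\<in>S. F (smul w1 p) (smul w2 q))"
      using S(2) F1 by (subst sum.cong[OF refl, of _ _ "\<lambda>_. 1"]) auto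
    also have "\<dots> \<le> (\<Sum>(p,q)\<in>{..<D} \<times> {..<D}. F (smul w1 p) (smul w2 q))"
      using S(1) by (intro sum_mono2) (auto simp: F_def)
    also have "\<dots> = (\<Sum>p<D. \<Sum>q<D. F (smul w1 p) (smul w2 q))"
      by (rule sum.cartesian_product[symmetric])
    also have "\<dots> = (\<Sum>p<D. \<Sum>q<D. F p q)" by (rule sum_smul[OF w1(2) w2(2)])
    also have "\<dots> = real D * purity D (conv (outer u) (outer v))" unfolding F_def purity_conv ..
    finally have "1 \<le> purity D (conv (outer u) (outer v))" using D_pos by simp
    moreover have "purity D (conv (outer u) (outer v)) \<le> 1"
      by (rule purity_le_1[OF density_op_conv[OF density_op_outer[OF u nu] v nv]])
    ultimately show ?thesis by (simp add: u_def)
  qed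
  with n\<phi> show ?thesis by (rule that)
qed

text \<open>The sum over \<open>x\<close> is a character sum and leaves only the diagonal; there the
  sum over \<open>y\<close> is the squared norm of \<phi>.\<close>

lemma T_twirl:
  assumes n\<phi>: "(\<Sum>i<D. (cmod (\<phi> i))\<^sup>2) = 1" and rs: "r < D" "s < D"
  shows "(\<Sum>x<D. \<Sum>y<D. T x y \<phi> r * cnj (T x y \<phi> s)) = (if r = s then of_nat D else 0)"
proof -
  have "(\<Sum>x<D. \<Sum>y<D. T x y \<phi> r * cnj (T x y \<phi> s))
      = (\<Sum>x<D. chi d (dot x r - dot x s)) * (\<Sum>y<D. \<phi> (lc 1 r (- 1) y) * cnj (\<phi> (lc 1 s (- 1) y)))"
    unfolding sum_product by (intro sum.cong refl) (simp add: T_def cnj_chi chi_diff mult_ac)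
  also have "\<dots> = (if r = s then of_nat D else 0)"
  proof (cases "r = s")
    case True
    have "(\<Sum>y<D. \<phi> (lc 1 r (- 1) y) * cnj (\<phi> (lc 1 r (- 1) y))) = (\<Sum>i<D. \<phi> i * cnj (\<phi> i))"
      by (rule sum_lc_right[OF unit_minus_1, of "\<lambda>i. \<phi> i * cnj (\<phi> i)"])
    also have "\<dots> = of_real (\<Sum>i<D. (cmod (\<phi> i))\<^sup>2)" by (simp only: of_real_sum complex_norm_square)
    finally show ?thesis using True n\<phi> by simp
  qed (simp add: chi_orthogonal[OF rs])
  finally show ?thesis .
qed

lemma maximal_holevo_capacity_if_stabilizer_state:
  assumes v: "v \<in> carrier_vec D" and nv: "(\<Sum>i<D. (cmod (v $ i))\<^sup>2) = 1"
    and st: "stabilizer_state d n v"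
  shows "holevo_capacity D (\<lambda>\<rho>. conv \<rho> (outer v)) = ln (real D)"
proof -
  interpret state_channel D "\<lambda>\<rho>. conv \<rho> (outer v)"
    by unfold_locales (rule density_op_conv[OF _ v nv])
  obtain \<phi> where n\<phi>: "(\<Sum>i<D. (cmod (\<phi> i))\<^sup>2) = 1"
    and pure: "\<And>x y. purity D (conv (outer (vec D (T x y \<phi>))) (outer v)) = 1"
    using pure_output_ensemble[OF v nv st] by blast
  \<comment> \<open>Ensembles are indexed by an initial segment of the naturals, so the two
    translation labels are packed into \<open>l < D * D\<close>.\<close>
  define R where "R l = outer (vec D (T (l div D) (l mod D) \<phi>))" for l
  have dens: "density_op D (R l)" for l
    unfolding R_def using n\<phi> sum_norm_T[of "l div D" "l mod D" \<phi>]
    by (intro density_op_outer) simp_all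
  have twirl: "(\<Sum>l<D * D. R l $$ (r,s)) = (if r = s then of_nat D else 0)" if "r < D" "s < D" for r s
  proof -
    have "(\<Sum>l<D * D. R l $$ (r,s)) = (\<Sum>(x,y)\<in>{..<D} \<times> {..<D}. T x y \<phi> r * cnj (T x y \<phi> s))"
    proof (rule sum.reindex_bij_witness[of _ "\<lambda>(x,y). x * D + y" "\<lambda>l. (l div D, l mod D)"])
      fix l assume "l \<in> {..<D * D}"
      then show "(l div D, l mod D) \<in> {..<D} \<times> {..<D}" using D_pos by (simp add: less_mult_imp_div_less)
    next
      fix xy assume "xy \<in> {..<D} \<times> {..<D}"
      then obtain x y where xy: "xy = (x,y)" "x < D" "y < D" by auto
      have "x * D + y < Suc x * D" using xy by simp
      also have "\<dots> \<le> D * D" using xy by (intro mult_right_mono) auto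
      finally show "(case xy of (x,y) \<Rightarrow> x * D + y) \<in> {..<D * D}" by (simp add: xy)
    qed (use that in \<open>auto simp: R_def outer_def div_mult_mod_eq\<close>)
    also have "\<dots> = (\<Sum>x<D. \<Sum>y<D. T x y \<phi> r * cnj (T x y \<phi> s))"
      by (rule sum.cartesian_product[symmetric])
    finally show ?thesis using T_twirl[OF n\<phi> that] by simp
  qed
  define p where "p = (\<lambda>_::nat. 1 / (real D * real D))"
  \<comment> \<open>The output is linear in the input, so the sum over \<open>l\<close> can be taken
    inside, where \<open>twirl\<close> evaluates it.\<close>
  have mean: "ensemble_mean D (D * D) p (\<lambda>l. conv (R l) (outer v))
      = mat D D (\<lambda>(i,j). if i = j then of_real (1 / real D) else 0)" (is "?L = ?R")
  proof (rule eq_matI)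
    fix i j assume "i < dim_row ?R" "j < dim_col ?R"
    then have ij: "i < D" "j < D" by auto
    have "?L $$ (i,j) = (\<Sum>l<D * D. of_real (1 / (real D * real D)) *
        (\<Sum>b<D. R l $$ (bwd1 i b, bwd1 j b) * outer v $$ (bwd2 i b, bwd2 j b)))"
      using ij by (simp add: ensemble_mean_def p_def conv_entry)
    also have "\<dots> = of_real (1 / (real D * real D)) *
        (\<Sum>b<D. (\<Sum>l<D * D. R l $$ (bwd1 i b, bwd1 j b)) * outer v $$ (bwd2 i b, bwd2 j b))"
      unfolding sum_distrib_left[symmetric] sum_distrib_right
      by (rule arg_cong[where f = "\<lambda>x. _ * x"]) (rule sum.swap)
    also have "\<dots> = of_real (1 / (real D * real D)) *
        (\<Sum>b<D. (if bwd1 i b = bwd1 j b then of_nat D else 0) * outer v $$ (bwd2 i b, bwd2 j b))"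
      by (simp add: twirl)
    also have "\<dots> = (if i = j then of_real (1 / real D) else 0)"
    proof (cases "i = j")
      case True
      have "(\<Sum>b<D. outer v $$ (bwd2 i b, bwd2 i b)) = (\<Sum>b<D. outer v $$ (b,b))"
        by (rule sum_lc_right[OF g11, of "\<lambda>b. outer v $$ (b,b)"])
      also have "\<dots> = 1" using density_op_outer[OF v nv] by (simp add: density_op_def)
      finally have "(\<Sum>b<D. of_nat D * outer v $$ (bwd2 i b, bwd2 i b)) = of_nat D"
        by (simp flip: sum_distrib_left)
      then show ?thesis using True d_pos by simp
    next
      case False
      obtain \<gamma> where \<gamma>: "[\<gamma> * g00 = 1] (mod int d)" using unit_inverse[OF g00] by blast
      have inv: "lc \<gamma> (bwd1 a b) (- (\<gamma> * g10)) b = a" if "a < D" for a b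
        using lc_cong[OF \<gamma>, of "\<gamma> * g10 + - (\<gamma> * g10)" 0 a b] that
        unfolding lc_lc_left by (simp add: lc_1_0)
      \<comment> \<open>As \<open>g00\<close> is a unit, \<open>bwd1\<close> is injective in its
        first argument. Off-diagonal output entries therefore meet only off-diagonal entries of the
        twirled input, which vanish.\<close>
      have "bwd1 i b \<noteq> bwd1 j b" for b using inv[OF ij(1)] inv[OF ij(2)] False by metis
      then show ?thesis using False by simp
    qed
    finally show "?L $$ (i,j) = ?R $$ (i,j)" using ij by simp
  qed (simp_all add: ensemble_mean_def)
  show ?thesis
  proof (rule maximal_holevo_capacityI[of "D * D" p R])
    show "(\<Sum>i<D * D. p i) = 1" using d_pos by (simp add: p_def)
    show "\<forall>i<D * D. 0 \<le> p i \<and> density_op D (R i)" using dens by (simp add: p_def)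
    show "purity D (conv (R i) (outer v)) = 1" for i unfolding R_def by (rule pure)
    show "0 < D * D" by simp
  qed (use mean in simp_all)
qed

lemma maximal_holevo_capacity_iff_stabilizer_state:
  assumes v: "v \<in> carrier_vec D" and nv: "(\<Sum>i<D. (cmod (v $ i))\<^sup>2) = 1"
  shows "holevo_capacity D (\<lambda>\<rho>. conv \<rho> (outer v)) = ln (real D) \<longleftrightarrow> stabilizer_state d n v"
proof
  assume cap: "holevo_capacity D (\<lambda>\<rho>. conv \<rho> (outer v)) = ln (real D)"
  interpret state_channel D "\<lambda>\<rho>. conv \<rho> (outer v)"
    by unfold_locales (rule density_op_conv[OF _ v nv])
  show "stabilizer_state d n v"
    using maximal_holevo_capacity_imp_nearly_pure[OF cap _ density_op_outer[OF v nv]]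
    by (intro stabilizer_state_if_nearly_pure_outputs[OF v nv]) blast
qed (rule maximal_holevo_capacity_if_stabilizer_state[OF v nv])

end

theorem mainTheorem16:
  fixes d n :: nat and g00 g01 g10 g11 :: int and \<psi> :: "complex vec"
  assumes "prime d"
    and "n \<ge> 1"
    and "\<not> [g00 = 0] (mod int d)" and "\<not> [g01 = 0] (mod int d)"
    and "\<not> [g10 = 0] (mod int d)" and "\<not> [g11 = 0] (mod int d)"
    and "\<not> [g00 * g11 - g01 * g10 = 0] (mod int d)"
    and "\<psi> \<in> carrier_vec (d ^ n)"
    and "(\<Sum>i<d ^ n. (cmod (\<psi> $ i))\<^sup>2) = 1"
  shows "holevo_capacity (d ^ n) (\<lambda>\<rho>. boxtimes d n g00 g01 g10 g11 \<rho> (outer \<psi>))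
           = real n * ln (real d)
         \<longleftrightarrow> stabilizer_state d n \<psi>"
proof -
  interpret qudit_convolution d n g00 g01 g10 g11 using assms by unfold_locales auto
  have "ln (real (d ^ n)) = real n * ln (real d)" using d_pos by (simp add: ln_realpow)
  then show ?thesis using maximal_holevo_capacity_iff_stabilizer_state[OF assms(8,9)] by simp
qed

end
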